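(* Let $q$ be a prime power, $R=\mathbb{F}_q+u\mathbb{F}_q=\mathbb{F}_q[u]/(u^2)$, and let $\mathcal{C}$ be a linear code over $R$ with generator matrix $G$ having $k$ rows. Write $GG^T=A_0+uA_1$ with $A_0,A_1\in M_k(\mathbb{F}_q)$, and let $\ell=\dim\operatorname{Rad}(A_0)$. Let $U$ be a $k\times k$ invertible matrix over $\mathbb{F}_q$ whose first $\ell$ rows form a basis of $\operatorname{Rad}(A_0)$. Then $\tilde{\mathcal{C}}$ is a shortest LCD embedding of $\mathcal{C}$ if and only if it has a generator matrix $$\tilde G=[G\mid B],\qquad B=U^{-1}\begin{pmatrix} D \\ E \end{pmatrix},$$ for some $D\in GL_\ell(R)$ and some $(k-\ell)\times\ell$ matrix $E$ over $R$.
   Context: A linear code $\mathcal{C}$ of length $n$ over $R$ is an $R$-submodule of $R^n$. A generator matrix $G$ of $\mathcal{C}$ is a matrix whose rows $\mathbf{c}_1,\dots,\mathbf{c}_{k_1}\in R^n\setminus(uR)^n$ and $\mathbf{c}_{k_1+1},\dots,\mathbf{c}_{k_1+k_2}\in(uR)^n$ are codewords such that every codeword has a unique representation $\sum_{i=1}^{k_1}a_i\mathbf{c}_i+\sum_{j=k_1+1}^{k_1+k_2}b_j\mathbf{c}_j$ with $a_i\in R$, $b_j\in\mathbb{F}_q$. For a symmetric $k\times k$ matrix $A$ over $\mathbb{F}_q$, $\operatorname{Rad}(A)=\{\mathbf{x}\in\mathbb{F}_q^k : \mathbf{x}A=\mathbf{0}\}$. The dual of a code $\mathcal{D}\subseteq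 R^N$ is $\mathcal{D}^\perp=\{\mathbf{x}\in R^N : \mathbf{x}\cdot\mathbf{c}=0\text{ for all }\mathbf{c}\in\mathcal{D}\}$ (standard dot product), and $\mathcal{D}$ is LCD if $\mathcal{D}\cap\mathcal{D}^\perp=\{0\}$. An LCD embedding of $\mathcal{C}$ is an LCD code over $R$ generated by the rows of $[G\mid B]$ for some matrix $B$ over $R$ (possibly with zero columns). A shortest LCD embedding of $\mathcal{C}$ is one whose length is smallest among all LCD embeddings of $\mathcal{C}$. Known fact (Bhowmick et al.): every LCD code over $R$ is free, and a free code with generator matrix $G$ is LCD if and only if $GG^T$ is invertible. *)

theory Defs
  imports
    "Jordan_Normal_Form.Matrix_Kernel"
    "Jordan_Normal_Form.Gauss_Jordan_Elimination"
begin

section \<open>The ring \<open>R = F + uF\<close> with \<open>u\<^sup>2 = 0\<close>\<close>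

text \<open>\<open>Dual a b\<close> stands for \<open>a + u b\<close>.\<close>

datatype 'a dual_num = Dual (res: 'a) (upart: 'a)

instantiation dual_num :: (comm_ring_1) comm_ring_1
begin

definition "0 = Dual 0 0"
definition "1 = Dual 1 0"
definition "x + y = Dual (res x + res y) (upart x + upart y)"
definition "x - y = Dual (res x - res y) (upart x - upart y)"
definition "- x = Dual (- res x) (- upart x)"
definition "x * y = Dual (res x * res y) (res x * upart y + upart x * res y)"

instance
  by standard
    (simp_all add: zero_dual_num_def one_dual_num_def plus_dual_num_def minus_dual_num_def
      uminus_dual_num_def times_dual_num_def algebra_simps dual_num.expand)

end

definition emb :: "'a::comm_ring_1 \<Rightarrow> 'a dual_num" where
  "emb a = Dual a 0"

definition u :: "'a::comm_ring_1 dual_num" where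
  "u = Dual 0 1"

text \<open>Evaluation at \<open>u\<close> is a surjective ring homomorphism \<open>F[X] \<rightarrow> R\<close> with kernel
  \<open>(X\<^sup>2)\<close>, so \<open>R\<close> is the quotient \<open>F[X]/(X\<^sup>2)\<close>.\<close>

definition poly_to_dual_num :: "'a::comm_ring_1 poly \<Rightarrow> 'a dual_num" where
  "poly_to_dual_num p = Dual (coeff p 0) (coeff p 1)"

lemma poly_to_dual_num_hom:
  "poly_to_dual_num 1 = 1"
  "poly_to_dual_num (p + q) = poly_to_dual_num p + poly_to_dual_num q"
  "poly_to_dual_num (p * q) = poly_to_dual_num p * poly_to_dual_num q"
  by (simp_all add: poly_to_dual_num_def one_dual_num_def plus_dual_num_def times_dual_num_def
      coeff_mult)

lemma poly_to_dual_num_gens: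
  "poly_to_dual_num [:a:] = emb a"
  "poly_to_dual_num [:0, 1:] = u"
  by (simp_all add: poly_to_dual_num_def emb_def u_def)

lemma poly_to_dual_num_surj: "surj poly_to_dual_num"
proof (rule surjI)
  fix x :: "'a dual_num"
  show "poly_to_dual_num [:res x, upart x:] = x"
    by (simp add: poly_to_dual_num_def)
qed

lemma poly_to_dual_num_kernel:
  "poly_to_dual_num p = 0 \<longleftrightarrow> monom 1 2 dvd p"
  by (auto simp: poly_to_dual_num_def zero_dual_num_def monom_1_dvd_iff' less_2_cases_iff)

section \<open>Linear codes over \<open>R\<close>\<close>

text \<open>For a row vector \<open>x\<close>, the product \<open>x A\<close> is written \<open>transpose_mat A *\<^sub>v x\<close>;
  its value is \<open>\<Sum>\<^sub>i x\<^sub>i A\<^sub>i\<close> with \<open>A\<^sub>i\<close> the rows of \<open>A\<close>.\<close>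

definition linear_code :: "nat \<Rightarrow> 'a::comm_ring_1 dual_num vec set \<Rightarrow> bool" where
  "linear_code n C \<longleftrightarrow>
     LinearCombinations.submodule class_ring C (module_vec TYPE('a dual_num) n)"

definition uR_vecs :: "nat \<Rightarrow> 'a::comm_ring_1 dual_num vec set" where
  "uR_vecs n = {x \<in> carrier_vec n. \<forall>i<n. x $ i \<in> range (\<lambda>r. u * r)}"

text \<open>The first \<open>k1\<close> rows take coefficients in \<open>R\<close>, the remaining ones, which
  lie in \<open>(uR)\<^sup>n\<close>, only coefficients in \<open>F\<close>.\<close>

definition generator_matrix ::
  "nat \<Rightarrow> 'a::comm_ring_1 dual_num vec set \<Rightarrow> 'a dual_num mat \<Rightarrow> bool" where
  "generator_matrix n C G \<longleftrightarrow>
     linear_code n C \<and> dim_col G = n \<and> set (rows G) \<subseteq> C \<and>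
     (\<exists>k1 \<le> dim_row G.
        (\<forall>i<k1. row G i \<notin> uR_vecs n) \<and>
        (\<forall>i. k1 \<le> i \<and> i < dim_row G \<longrightarrow> row G i \<in> uR_vecs n) \<and>
        (\<forall>c\<in>C. \<exists>!a. a \<in> carrier_vec (dim_row G) \<and>
           (\<forall>i. k1 \<le> i \<and> i < dim_row G \<longrightarrow> a $ i \<in> range emb) \<and>
           c = transpose_mat G *\<^sub>v a))"

definition dual_code :: "nat \<Rightarrow> 'a::comm_ring_1 dual_num vec set \<Rightarrow> 'a dual_num vec set" where
  "dual_code n C = {x \<in> carrier_vec n. \<forall>c\<in>C. x \<bullet> c = 0}"

definition lcd_code :: "nat \<Rightarrow> 'a::comm_ring_1 dual_num vec set \<Rightarrow> bool" where
  "lcd_code n C \<longleftrightarrow> linear_code n C \<and> C \<inter> dual_code n C = {0\<^sub>v n}"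

definition append_cols :: "'a::zero mat \<Rightarrow> 'a mat \<Rightarrow> 'a mat" where
  "append_cols A B = four_block_mat A B (0\<^sub>m 0 (dim_col A)) (0\<^sub>m 0 (dim_col B))"

text \<open>\<open>lcd_embedding n C N D\<close>: the code \<open>D\<close> of length \<open>N\<close> is an LCD embedding of the
  code \<open>C\<close> of length \<open>n\<close>.\<close>

definition lcd_embedding ::
  "nat \<Rightarrow> 'a::comm_ring_1 dual_num vec set \<Rightarrow> nat \<Rightarrow> 'a dual_num vec set \<Rightarrow> bool" where
  "lcd_embedding n C N D \<longleftrightarrow>
     lcd_code N D \<and>
     (\<exists>G B. generator_matrix n C G \<and> dim_row B = dim_row G \<and> N = n + dim_col B \<and>
        D = LinearCombinations.module.span class_ring (module_vec TYPE('a dual_num) N)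
              (set (rows (append_cols G B))))"

definition shortest_lcd_embedding ::
  "nat \<Rightarrow> 'a::comm_ring_1 dual_num vec set \<Rightarrow> nat \<Rightarrow> 'a dual_num vec set \<Rightarrow> bool" where
  "shortest_lcd_embedding n C N D \<longleftrightarrow>
     lcd_embedding n C N D \<and> (\<forall>N' D'. lcd_embedding n C N' D' \<longrightarrow> N \<le> N')"

section \<open>The radical of a matrix over the residue field\<close>

definition Rad :: "'a::field mat \<Rightarrow> 'a vec set" where
  "Rad A = {x \<in> carrier_vec (dim_row A). transpose_mat A *\<^sub>v x = 0\<^sub>v (dim_col A)}"

abbreviation Rad_space :: "'a::field mat \<Rightarrow> ('a, 'a vec) module" where
  "Rad_space A \<equiv> (module_vec TYPE('a) (dim_row A)) \<lparr>carrier := Rad A\<rparr>"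

end

theory Submission
  imports Defs
begin

text \<open>For a generator matrix \<open>G\<close>, the rows of \<open>[G | B]\<close> span an LCD code iff the Gram matrix \<open>G G\<^sup>T + B B\<^sup>T\<close> is
  invertible, and this can be tested modulo \<open>u\<close>, on \<open>M = A\<^sub>0 + B\<^sub>0 B\<^sub>0\<^sup>T\<close> with \<open>B\<^sub>0\<close> the residue
  of \<open>B\<close>. Let the rows of \<open>R\<close> be a basis of the radical of \<open>A\<^sub>0\<close>. If \<open>M\<close> is invertible, then
  \<open>c \<mapsto> c R B\<^sub>0\<close> is injective, so \<open>B\<close> has at least \<open>l\<close> columns. If \<open>B\<close> has exactly \<open>l\<close> columns, then
  \<open>M\<close> is invertible iff \<open>R B\<^sub>0\<close> is: multiplying \<open>z M = 0\<close> by \<open>R\<close> kills \<open>A\<^sub>0\<close> and gives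
  \<open>z B\<^sub>0 = 0\<close>, whence \<open>z\<close> is in the radical. With \<open>R\<close> the first \<open>l\<close> rows of \<open>U\<close>, the matrix \<open>R B\<close>
  is the block \<open>D\<close> of the theorem. Finally, two generator matrices of the same code differ by an invertible
  left factor, so it suffices to consider embeddings built from \<open>G\<close> itself.\<close>

text \<open>Finiteness of \<open>R\<close> allows surjectivity of a square matrix to be deduced from
  injectivity by counting, over \<open>R\<close> exactly as over the residue field.\<close>

instance dual_num :: (finite) finite
proof
  have "UNIV = (\<lambda>(x, y). Dual x y) ` (UNIV :: ('a \<times> 'a) set)"
    by (auto simp: image_iff) (metis dual_num.exhaust)
  then show "finite (UNIV :: 'a dual_num set)"
    by (metis finite_code finite_imageI)
qed

lemma mult_mat_vec_smult:
  fixes A :: "'a::comm_ring_1 mat"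
  assumes "A \<in> carrier_mat m n" "v \<in> carrier_vec n"
  shows "A *\<^sub>v (c \<cdot>\<^sub>v v) = c \<cdot>\<^sub>v (A *\<^sub>v v)"
  using assms by (intro eq_vecI) (auto simp: scalar_prod_smult_distrib[of _ n])

lemma mult_mat_zero_vec:
  fixes A :: "'a::comm_ring_1 mat"
  assumes "A \<in> carrier_mat m n"
  shows "A *\<^sub>v 0\<^sub>v n = 0\<^sub>v m"
  using assms by (intro eq_vecI) auto

section \<open>Matrices with trivial kernel\<close>

text \<open>Serves as the working form of invertibility: equivalent to it for square matrices over a
  finite ring, yet meaningful for rectangular ones, and well behaved under reduction modulo
  \<open>u\<close>.\<close>

definition inj_mat :: "'a::comm_ring_1 mat \<Rightarrow> bool" where
  "inj_mat A \<longleftrightarrow> (\<forall>x\<in>carrier_vec (dim_col A). A *\<^sub>v x = 0\<^sub>v (dim_row A) \<longrightarrow> x = 0\<^sub>v (dim_col A))"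

lemma inj_matI:
  assumes "A \<in> carrier_mat m n"
    and "\<And>x. x \<in> carrier_vec n \<Longrightarrow> A *\<^sub>v x = 0\<^sub>v m \<Longrightarrow> x = 0\<^sub>v n"
  shows "inj_mat A"
  using assms by (auto simp: inj_mat_def)

lemma inj_matD:
  assumes "inj_mat A" "A \<in> carrier_mat m n" "x \<in> carrier_vec n" "A *\<^sub>v x = 0\<^sub>v m"
  shows "x = 0\<^sub>v n"
  using assms by (auto simp: inj_mat_def)

lemma inj_mat_inj_on:
  assumes "inj_mat A" "A \<in> carrier_mat m n"
  shows "inj_on ((*\<^sub>v) A) (carrier_vec n)"
proof (rule inj_onI)
  fix x y assume x: "x \<in> carrier_vec n" and y: "y \<in> carrier_vec n" and e: "A *\<^sub>v x = A *\<^sub>v y"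
  have "A *\<^sub>v (x - y) = 0\<^sub>v m"
    using mult_minus_distrib_mat_vec[OF assms(2) x y] e assms(2) y by simp
  then have *: "x - y = 0\<^sub>v n"
    using inj_matD[OF assms] x y by simp
  show "x = y"
  proof (rule eq_vecI)
    fix i assume "i < dim_vec y"
    then show "x $ i = y $ i"
      using arg_cong[OF *, of "\<lambda>v. v $ i"] x y by simp
  qed (use x y in simp)
qed

lemma inj_mat_leftI:
  assumes "A \<in> carrier_mat m n" "B \<in> carrier_mat n m" "B * A = 1\<^sub>m n"
  shows "inj_mat A"
proof (rule inj_matI[OF assms(1)])
  fix x :: "'a vec" assume x: "x \<in> carrier_vec n" "A *\<^sub>v x = 0\<^sub>v m"
  have "x = (B * A) *\<^sub>v x" using assms x by simp
  also have "\<dots> = B *\<^sub>v (A *\<^sub>v x)" by (rule assoc_mult_mat_vec[OF assms(2,1) x(1)])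
  also have "\<dots> = 0\<^sub>v n" unfolding x(2) using assms(2) by (intro eq_vecI) auto
  finally show "x = 0\<^sub>v n" .
qed

section \<open>Counting vectors over a finite ring; injective square matrices are invertible\<close>

lemma card_carrier_vec: "card (carrier_vec n :: 'a::finite vec set) = card (UNIV :: 'a set) ^ n"
  and finite_carrier_vec: "finite (carrier_vec n :: 'a::finite vec set)"
proof -
  have e: "{xs :: 'a list. set xs \<subseteq> UNIV \<and> length xs = n} = {xs. length xs = n}" by auto
  have b: "bij_betw list_of_vec (carrier_vec n :: 'a vec set) {xs. length xs = n}"
    by (rule bij_betw_byWitness[where f' = vec_of_list])
      (auto simp: vec_list list_vec intro!: carrier_vecI)
  from bij_betw_same_card[OF b] show "card (carrier_vec n :: 'a vec set) = card (UNIV :: 'a set) ^ n"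
    using card_lists_length_eq[of "UNIV :: 'a set" n] e by simp
  show "finite (carrier_vec n :: 'a vec set)"
    using bij_betw_finite[OF b] finite_lists_length_eq[of "UNIV :: 'a set" n] e by simp
qed

text \<open>Compare the numbers of vectors, \<open>q^n <= q^m\<close> with \<open>q\<close> the size
  of the ring; \<open>0\<close> and \<open>1\<close> are distinct, so \<open>q > 1\<close> and the
  exponents compare.\<close>

lemma inj_mat_dim_le:
  fixes A :: "'a::{comm_ring_1, finite} mat"
  assumes "inj_mat A" "A \<in> carrier_mat m n"
  shows "n \<le> m"
proof -
  have "card (carrier_vec n :: 'a vec set) \<le> card (carrier_vec m :: 'a vec set)"
    using assms by (intro card_inj_on_le[OF inj_mat_inj_on[OF assms]])
      (auto simp: finite_carrier_vec)
  moreover have "1 < card (UNIV :: 'a set)"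
    using card_mono[of UNIV "{0, 1 :: 'a}"] by simp
  ultimately show ?thesis by (simp add: card_carrier_vec)
qed

text \<open>An injective self-map of a finite set is onto, and preimages of the unit vectors are the
  columns of \<open>X\<close>.\<close>

lemma inj_mat_right_inverse:
  fixes A :: "'a::{comm_ring_1, finite} mat"
  assumes A: "inj_mat A" "A \<in> carrier_mat n n"
  obtains X where "X \<in> carrier_mat n n" "A * X = 1\<^sub>m n"
proof -
  have "(*\<^sub>v) A ` carrier_vec n = carrier_vec n"
    using A inj_mat_inj_on[OF A] by (intro endo_inj_surj) (auto simp: finite_carrier_vec)
  then have "\<exists>x. x \<in> carrier_vec n \<and> A *\<^sub>v x = y" if "y \<in> carrier_vec n" for y
    using that by (smt (verit) imageE)
  then have "\<forall>j\<in>{..<n}. \<exists>x. x \<in> carrier_vec n \<and> A *\<^sub>v x = unit_vec n j"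
    by simp
  then obtain f where f: "\<And>j. j < n \<Longrightarrow> f j \<in> carrier_vec n \<and> A *\<^sub>v f j = unit_vec n j"
    using bchoice[of "{..<n}"] by (metis lessThan_iff)
  define X where "X = mat_of_cols n (map f [0..<n])"
  have X: "X \<in> carrier_mat n n" by (simp add: X_def mat_of_cols_def)
  have cX: "col X j = f j" if "j < n" for j
    using that f[OF that] by (simp add: X_def col_mat_of_cols)
  have "A * X = 1\<^sub>m n"
  proof (rule mat_col_eqI)
    fix j assume "j < dim_col (1\<^sub>m n :: 'a mat)"
    then show "col (A * X) j = col (1\<^sub>m n) j"
      using col_mult2[OF A(2) X] cX f by simp
  qed (use A X in auto)
  with X show ?thesis by (rule that)
qed

text \<open>The right inverse \<open>X\<close> has \<open>A\<close> as a left inverse, so it is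
  injective and has a right inverse \<open>Y\<close> of its own; then
  \<open>A = A (X Y) = Y\<close>.\<close>

lemma inj_mat_inverse:
  fixes A :: "'a::{comm_ring_1, finite} mat"
  assumes A: "inj_mat A" "A \<in> carrier_mat n n"
  obtains X where "X \<in> carrier_mat n n" "A * X = 1\<^sub>m n" "X * A = 1\<^sub>m n"
proof -
  from inj_mat_right_inverse[OF A] obtain X where X: "X \<in> carrier_mat n n" "A * X = 1\<^sub>m n" .
  obtain Y where Y: "Y \<in> carrier_mat n n" "X * Y = 1\<^sub>m n"
    using inj_mat_right_inverse[OF inj_mat_leftI[OF X(1) A(2) X(2)] X(1)] .
  have "A = A * (X * Y)" using Y A by simp
  also have "\<dots> = A * X * Y" by (rule assoc_mult_mat[OF A(2) X(1) Y(1), symmetric])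
  also have "\<dots> = Y" using X Y by simp
  finally show ?thesis using that X Y by simp
qed

lemma invertible_mat_iff_inj_mat:
  fixes A :: "'a::{comm_ring_1, finite} mat"
  assumes A: "A \<in> carrier_mat n n"
  shows "invertible_mat A \<longleftrightarrow> inj_mat A"
proof
  assume "invertible_mat A"
  then obtain B where B: "A * B = 1\<^sub>m n" "B * A = 1\<^sub>m (dim_row B)"
    using A by (auto simp: invertible_mat_def inverts_mat_def)
  have "B \<in> carrier_mat n n"
    using A arg_cong[OF B(1), of dim_col] arg_cong[OF B(2), of dim_col] by auto
  then show "inj_mat A" using inj_mat_leftI[OF A] B by auto
next
  assume "inj_mat A"
  from inj_mat_inverse[OF this A] obtain X
    where "X \<in> carrier_mat n n" "A * X = 1\<^sub>m n" "X * A = 1\<^sub>m n" .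
  then show "invertible_mat A"
    using A by (auto simp: invertible_mat_def inverts_mat_def)
qed

lemma inj_mat_transpose:
  fixes A :: "'a::{comm_ring_1, finite} mat"
  assumes A: "inj_mat A" "A \<in> carrier_mat n n"
  shows "inj_mat (transpose_mat A)"
proof -
  from inj_mat_inverse[OF A] obtain X
    where X: "X \<in> carrier_mat n n" "A * X = 1\<^sub>m n" .
  show ?thesis
    using X A transpose_mult[OF A(2) X(1)]
    by (intro inj_mat_leftI[of _ n n "transpose_mat X"]) auto
qed

section \<open>Solvability of linear systems over a field\<close>

text \<open>Induction on the number of functionals: pass to the hyperplane of \<open>V\<close> on
  which the last one vanishes and correct by a multiple of it. The subspace \<open>V\<close> is kept
  general because it shrinks at each step.\<close>

lemma functional_in_span:
  fixes b :: "'a::field vec" and m :: nat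
  assumes "V \<subseteq> carrier_vec n" "\<And>x y. x \<in> V \<Longrightarrow> y \<in> V \<Longrightarrow> x + y \<in> V"
    and "\<And>t x. x \<in> V \<Longrightarrow> t \<cdot>\<^sub>v x \<in> V"
    and "\<And>i. i < m \<Longrightarrow> r i \<in> carrier_vec n" "b \<in> carrier_vec n"
    and "\<And>x. x \<in> V \<Longrightarrow> (\<And>i. i < m \<Longrightarrow> x \<bullet> r i = 0) \<Longrightarrow> x \<bullet> b = 0"
  shows "\<exists>c. \<forall>x\<in>V. x \<bullet> b = (\<Sum>i<m. c i * (x \<bullet> r i))"
  using assms
proof (induction m arbitrary: V)
  case 0
  then show ?case by simp
next
  case (Suc m)
  note V = Suc.prems
  have rm: "r m \<in> carrier_vec n" and ri: "\<And>i. i < m \<Longrightarrow> r i \<in> carrier_vec n" using V(4) by auto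
  define V' where "V' = {x \<in> V. x \<bullet> r m = 0}"
  have lin: "(x + t \<cdot>\<^sub>v y) \<bullet> z = x \<bullet> z + t * (y \<bullet> z)"
    if "x \<in> V" "y \<in> V" "z \<in> carrier_vec n" for x y z t
    using that V(1) by (subst add_scalar_prod_distrib[of _ n]) auto
  have "\<exists>c. \<forall>x\<in>V'. x \<bullet> b = (\<Sum>i<m. c i * (x \<bullet> r i))"
  proof (rule Suc.IH)
    show "V' \<subseteq> carrier_vec n" using V(1) by (auto simp: V'_def)
    show "x + y \<in> V'" if "x \<in> V'" "y \<in> V'" for x y
      using that V(1,2) rm add_scalar_prod_distrib[of x n y "r m"] by (auto simp: V'_def)
    show "t \<cdot>\<^sub>v x \<in> V'" if "x \<in> V'" for t x
      using that V(1,3) rm by (auto simp: V'_def)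
    show "x \<bullet> b = 0" if "x \<in> V'" "\<And>i. i < m \<Longrightarrow> x \<bullet> r i = 0" for x
      using that V(6)[of x] by (auto simp: V'_def less_Suc_eq)
  qed (use V(5) ri in auto)
  then obtain c where c: "\<And>x. x \<in> V' \<Longrightarrow> x \<bullet> b = (\<Sum>i<m. c i * (x \<bullet> r i))" by blast
  show ?case
  proof (cases "V' = V")
    case True
    then show ?thesis
      using c by (intro exI[of _ "c(m := 0)"]) auto
  next
    case False
    then obtain x0 where x0: "x0 \<in> V" "x0 \<bullet> r m \<noteq> 0" by (auto simp: V'_def)
    define s where "s = x0 \<bullet> r m"
    \<comment> \<open>The coefficient that makes the wanted identity true at \<open>x0\<close>;
      every vector of \<open>V\<close> differs from one in \<open>V'\<close> by a multiple of
      \<open>x0\<close>.\<close>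
    define d where "d = (x0 \<bullet> b - (\<Sum>i<m. c i * (x0 \<bullet> r i))) / s"
    have "x \<bullet> b = (\<Sum>i<m. c i * (x \<bullet> r i)) + d * (x \<bullet> r m)" if x: "x \<in> V" for x
    proof -
      define t where "t = - (x \<bullet> r m) / s"
      have "x + t \<cdot>\<^sub>v x0 \<in> V'"
        using x x0 V(2,3) lin[OF x x0(1) rm] by (auto simp: V'_def t_def s_def)
      from c[OF this] have "x \<bullet> b + t * (x0 \<bullet> b) = (\<Sum>i<m. c i * (x \<bullet> r i + t * (x0 \<bullet> r i)))"
        using lin[OF x x0(1)] V(5) ri by simp
      also have "\<dots> = (\<Sum>i<m. c i * (x \<bullet> r i)) + t * (\<Sum>i<m. c i * (x0 \<bullet> r i))"
        by (simp add: algebra_simps sum.distrib sum_distrib_left)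
      finally show ?thesis
        by (simp add: t_def d_def algebra_simps diff_divide_distrib)
    qed
    then show ?thesis
      by (intro exI[of _ "c(m := d)"]) auto
  qed
qed

text \<open>A vector orthogonal to the kernel induces a functional vanishing wherever all rows do,
  so it is a combination of the rows. Testing on unit vectors recovers the coordinates.\<close>

lemma row_space_of_orthogonal:
  fixes A :: "'a::field mat"
  assumes A: "A \<in> carrier_mat m n" and b: "b \<in> carrier_vec n"
    and orth: "\<And>x. x \<in> carrier_vec n \<Longrightarrow> A *\<^sub>v x = 0\<^sub>v m \<Longrightarrow> x \<bullet> b = 0"
  obtains c where "c \<in> carrier_vec m" "b = transpose_mat A *\<^sub>v c"
proof -
  have comm: "row A i \<bullet> x = x \<bullet> row A i" if "x \<in> carrier_vec n" for x i
    using that A by (intro comm_scalar_prod[of _ n]) auto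
  have "\<exists>c. \<forall>x\<in>carrier_vec n. x \<bullet> b = (\<Sum>i<m. c i * (x \<bullet> row A i))"
  proof (rule functional_in_span[of _ n])
    fix x assume x: "x \<in> carrier_vec n" and "\<And>i. i < m \<Longrightarrow> x \<bullet> row A i = 0"
    then have "A *\<^sub>v x = 0\<^sub>v m" using A comm[OF x] by (intro eq_vecI) auto
    with orth x show "x \<bullet> b = 0" by simp
  qed (use A b in auto)
  then obtain c where c: "\<And>x. x \<in> carrier_vec n \<Longrightarrow> x \<bullet> b = (\<Sum>i<m. c i * (x \<bullet> row A i))" by blast
  have "b = transpose_mat A *\<^sub>v vec m c"
  proof (rule eq_vecI)
    fix j assume "j < dim_vec (transpose_mat A *\<^sub>v vec m c)"
    then have j: "j < n" using A by simp
    then have "b $ j = (\<Sum>i<m. c i * (A $$ (i, j)))"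
      using c[of "unit_vec n j"] b A by simp
    then show "b $ j = (transpose_mat A *\<^sub>v vec m c) $ j"
      using j A by (simp add: scalar_prod_def atLeast0LessThan mult.commute)
  qed (use A b in auto)
  then show ?thesis using that[of "vec m c"] by simp
qed

section \<open>Reduction modulo \<open>u\<close>\<close>

lemma dual_num_simps [simp]:
  "res 0 = 0" "upart 0 = 0" "res 1 = 1" "upart 1 = 0"
  "res (x + y) = res x + res y" "upart (x + y) = upart x + upart y"
  "res (x - y) = res x - res y" "upart (x - y) = upart x - upart y"
  "res (x * y) = res x * res y" "upart (x * y) = res x * upart y + upart x * res y"
  "res (emb a) = a" "upart (emb a) = 0" "res u = 0" "upart u = 1"
  by (simp_all add: zero_dual_num_def one_dual_num_def plus_dual_num_def minus_dual_num_def
      times_dual_num_def emb_def u_def)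

lemma dual_num_eq_iff: "x = y \<longleftrightarrow> res x = res y \<and> upart x = upart y"
  by (cases x; cases y) simp

interpretation res_hom: comm_ring_hom res
  by standard auto

interpretation emb_hom: comm_ring_hom emb
  by standard (auto simp: dual_num_eq_iff)

lemma range_emb: "x \<in> range emb \<longleftrightarrow> upart x = 0"
  by (auto simp: image_iff dual_num_eq_iff)

lemma range_u: "x \<in> range (\<lambda>r. u * r) \<longleftrightarrow> res x = 0"
proof
  assume "res x = 0"
  then have "x = u * emb (upart x)" by (simp add: dual_num_eq_iff)
  then show "x \<in> range (\<lambda>r. u * r)" by blast
qed auto

lemma map_vec_res_emb [simp]: "map_vec res (map_vec emb v) = v"
  by (intro eq_vecI) auto

lemma map_mat_res_emb [simp]: "map_mat res (map_mat emb A) = A"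
  by (intro eq_matI) auto

lemma map_vec_res_minus:
  assumes "dim_vec v = dim_vec w"
  shows "map_vec res (v - w) = map_vec res v - map_vec res w"
  using assms by (intro eq_vecI) auto

text \<open>The annihilator of \<open>u\<close> in \<open>R\<close> is \<open>uR\<close>. This
  converts statements modulo \<open>u\<close> into exact equations over \<open>R\<close> and
  back.\<close>

lemma smult_u_eq_0_iff: "u \<cdot>\<^sub>v v = 0\<^sub>v (dim_vec v) \<longleftrightarrow> map_vec res v = 0\<^sub>v (dim_vec v)"
  by (auto simp: vec_eq_iff dual_num_eq_iff)

lemma map_vec_res_eq_0D:
  assumes "map_vec res v = 0\<^sub>v n" "v \<in> carrier_vec n"
  shows "v = u \<cdot>\<^sub>v map_vec emb (map_vec upart v)"
  using assms by (auto simp: vec_eq_iff dual_num_eq_iff)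

lemma uR_vecs_iff: "x \<in> uR_vecs n \<longleftrightarrow> x \<in> carrier_vec n \<and> map_vec res x = 0\<^sub>v n"
  by (auto simp: uR_vecs_def range_u vec_eq_iff)

text \<open>Two reductions suffice because \<open>u^2 = 0\<close>. From \<open>A x = 0\<close> the
  residue of \<open>x\<close> vanishes, so \<open>x = u y\<close>; then \<open>u A y = 0\<close>
  forces the residue of \<open>A y\<close>, hence that of \<open>y\<close>, to vanish, and
  \<open>x = u y = 0\<close>.\<close>

lemma inj_mat_res_lift:
  assumes "inj_mat (map_mat res A)"
  shows "inj_mat A"
proof (rule inj_matI)
  show A: "A \<in> carrier_mat (dim_row A) (dim_col A)" by simp
  fix x assume x: "x \<in> carrier_vec (dim_col A)" and 0: "A *\<^sub>v x = 0\<^sub>v (dim_row A)"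
  have resD: "map_vec res y = 0\<^sub>v (dim_col A)"
    if "y \<in> carrier_vec (dim_col A)" "map_vec res (A *\<^sub>v y) = 0\<^sub>v (dim_row A)" for y
    using that res_hom.mult_mat_vec_hom[OF A that(1)] inj_matD[OF assms, of "dim_row A" "dim_col A"]
    by simp
  define y where "y = map_vec emb (map_vec upart x)"
  have y: "y \<in> carrier_vec (dim_col A)" using x by (simp add: y_def)
  have xy: "x = u \<cdot>\<^sub>v y"
    unfolding y_def using resD[OF x] 0 res_hom.vec_hom_zero x by (intro map_vec_res_eq_0D) auto
  have "u \<cdot>\<^sub>v (A *\<^sub>v y) = 0\<^sub>v (dim_row A)"
    using 0 mult_mat_vec_smult[OF A y] unfolding xy by simp
  then have "map_vec res (A *\<^sub>v y) = 0\<^sub>v (dim_row A)"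
    using smult_u_eq_0_iff[of "A *\<^sub>v y"] by simp
  from resD[OF y this] show "x = 0\<^sub>v (dim_col A)"
    unfolding xy using y smult_u_eq_0_iff[of y] by simp
qed

text \<open>For the converse of lifting, a left inverse over \<open>R\<close> reduces to a left
  inverse over the residue field.\<close>

lemma inj_mat_res_iff:
  fixes A :: "'a::{comm_ring_1, finite} dual_num mat"
  assumes A: "A \<in> carrier_mat n n"
  shows "inj_mat (map_mat res A) \<longleftrightarrow> inj_mat A"
proof
  assume "inj_mat A"
  from inj_mat_inverse[OF this A] obtain X where X: "X \<in> carrier_mat n n" "X * A = 1\<^sub>m n" .
  have "map_mat res X * map_mat res A = 1\<^sub>m n"
    using res_hom.mat_hom_mult[OF X(1) A] X(2) res_hom.mat_hom_one by metis
  then show "inj_mat (map_mat res A)"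
    using A X by (intro inj_mat_leftI[of _ n n "map_mat res X"]) auto
qed (rule inj_mat_res_lift)

section \<open>Row spaces\<close>

text \<open>Coefficients are indexed by row position, whereas a span is taken over the set of rows;
  repeated rows then need no special care. \<open>span_rows\<close> identifies the two.\<close>

definition row_combs :: "'a::comm_ring_1 mat \<Rightarrow> 'a vec set" where
  "row_combs H = (\<lambda>a. transpose_mat H *\<^sub>v a) ` carrier_vec (dim_row H)"

lemma row_combsI: "a \<in> carrier_vec (dim_row H) \<Longrightarrow> transpose_mat H *\<^sub>v a \<in> row_combs H"
  by (simp add: row_combs_def)

lemma module_vec_module: "module class_ring (module_vec TYPE('a::comm_ring_1) n)"
proof -
  interpret vec_module "TYPE('a)" n .
  show ?thesis by (rule module_axioms)
qed

lemma row_combs_submodule: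
  fixes H :: "'a::comm_ring_1 mat"
  shows "submodule class_ring (row_combs H) (module_vec TYPE('a) (dim_col H))"
proof -
  let ?T = "transpose_mat H" and ?k = "dim_row H"
  have T: "?T \<in> carrier_mat (dim_col H) ?k" by simp
  have "x + y \<in> row_combs H" if xy: "x \<in> row_combs H" "y \<in> row_combs H" for x y
  proof -
    from xy obtain a b where ab: "a \<in> carrier_vec ?k" "b \<in> carrier_vec ?k"
      and e: "x = ?T *\<^sub>v a" "y = ?T *\<^sub>v b"
      by (auto simp: row_combs_def)
    have "x + y = ?T *\<^sub>v (a + b)"
      unfolding e using mult_add_distrib_mat_vec[OF T ab] by simp
    then show ?thesis using row_combsI[of "a + b" H] ab by simp
  qed
  moreover have "c \<cdot>\<^sub>v x \<in> row_combs H" if xy: "x \<in> row_combs H" for c x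
  proof -
    from xy obtain a where a: "a \<in> carrier_vec ?k" and e: "x = ?T *\<^sub>v a"
      by (auto simp: row_combs_def)
    have "c \<cdot>\<^sub>v x = ?T *\<^sub>v (c \<cdot>\<^sub>v a)"
      unfolding e using mult_mat_vec_smult[OF T a] by simp
    then show ?thesis using row_combsI[of "c \<cdot>\<^sub>v a" H] a by simp
  qed
  moreover have "0\<^sub>v (dim_col H) \<in> row_combs H"
    using row_combsI[of "0\<^sub>v ?k" H] by (simp add: mult_mat_zero_vec[OF T])
  moreover have "row_combs H \<subseteq> carrier_vec (dim_col H)"
    by (auto simp: row_combs_def intro!: carrier_vecI)
  ultimately show ?thesis
    by (simp add: submodule_def module_vec_module module_vec_simps)
qed

lemma row_in_row_combs:
  fixes H :: "'a::comm_ring_1 mat"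
  assumes "i < dim_row H"
  shows "row H i \<in> row_combs H"
proof -
  have "row H i = transpose_mat H *\<^sub>v unit_vec (dim_row H) i"
    using assms by (intro eq_vecI) auto
  then show ?thesis using row_combsI[of "unit_vec (dim_row H) i" H] by simp
qed

lemma row_combs_subset:
  fixes H :: "'a::comm_ring_1 mat"
  assumes "set (rows H) \<subseteq> W" "submodule class_ring W (module_vec TYPE('a) (dim_col H))"
  shows "row_combs H \<subseteq> W"
proof
  interpret vec_module "TYPE('a)" "dim_col H" .
  fix x assume "x \<in> row_combs H"
  then obtain a where a: "a \<in> carrier_vec (dim_row H)" "x = transpose_mat H *\<^sub>v a"
    by (auto simp: row_combs_def)
  have "transpose_mat H = mat_of_cols (dim_col H) (rows H)"
    by (metis cols_transpose index_transpose_mat(2) mat_of_cols_cols)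
  moreover have "rows H ! i \<in> carrier_vec (dim_col H)" if "i < length (rows H)" for i
    using that by simp
  ultimately have "\<exists>f. x = lincomb f (set (rows H))"
    using mat_of_cols_mult_as_finsum[of a "rows H"] a by auto
  then have "x \<in> span (set (rows H))"
    by (auto simp: span_def)
  then show "x \<in> W" using span_is_subset[OF assms] by blast
qed

lemma span_rows:
  fixes H :: "'a::comm_ring_1 mat"
  assumes "dim_col H = n"
  shows "LinearCombinations.module.span class_ring (module_vec TYPE('a) n) (set (rows H))
    = row_combs H"
proof -
  interpret vec_module "TYPE('a)" "dim_col H" .
  have "set (rows H) \<subseteq> row_combs H"
    using row_in_row_combs[of _ H] by (auto simp: rows_def)
  moreover have "set (rows H) \<subseteq> carrier_vec (dim_col H)"
    by (rule rows_carrier)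
  ultimately show ?thesis
    using span_is_subset[OF _ row_combs_submodule] row_combs_subset[OF in_own_span span_is_submodule]
    unfolding assms[symmetric] by blast
qed

lemma linear_code_row_combs: "dim_col H = n \<Longrightarrow> linear_code n (row_combs H)"
  using row_combs_submodule[of H] by (simp add: linear_code_def)

lemma row_mult_mat:
  fixes Q H :: "'a::comm_ring_1 mat"
  assumes "Q \<in> carrier_mat k m" "H \<in> carrier_mat m n" "i < k"
  shows "row (Q * H) i = transpose_mat H *\<^sub>v row Q i"
  using assms by (intro eq_vecI) (auto intro: comm_scalar_prod[of _ m])

text \<open>The coefficient vectors expressing the rows of \<open>G\<close> through those of
  \<open>H\<close> become the rows of \<open>Q\<close>.\<close>

lemma rows_in_row_combs_factor:
  fixes G H :: "'a::comm_ring_1 mat"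
  assumes G: "G \<in> carrier_mat k n" and H: "H \<in> carrier_mat m n"
    and sub: "set (rows G) \<subseteq> row_combs H"
  obtains Q where "Q \<in> carrier_mat k m" "G = Q * H"
proof -
  have "\<forall>i\<in>{..<k}. \<exists>a. a \<in> carrier_vec m \<and> row G i = transpose_mat H *\<^sub>v a"
    using sub G H by (fastforce simp: rows_def row_combs_def)
  then obtain f where f: "\<forall>i\<in>{..<k}. f i \<in> carrier_vec m \<and> row G i = transpose_mat H *\<^sub>v f i"
    using bchoice by metis
  define Q where "Q = mat_of_rows m (map f [0..<k])"
  have Q: "Q \<in> carrier_mat k m" by (simp add: Q_def mat_of_rows_def)
  have "row Q i = f i" if "i < k" for i
    using that f by (simp add: Q_def)
  then have "row (Q * H) i = row G i" if "i < k" for i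
    using row_mult_mat[OF Q H that] f that by simp
  then have "G = Q * H"
    using G Q H by (intro eq_rowI) auto
  with Q show ?thesis by (rule that)
qed

lemma row_combs_mult_subset:
  fixes Q H :: "'a::comm_ring_1 mat"
  assumes Q: "Q \<in> carrier_mat k m" and H: "H \<in> carrier_mat m n"
  shows "row_combs (Q * H) \<subseteq> row_combs H"
proof
  fix x assume "x \<in> row_combs (Q * H)"
  then obtain a where a: "a \<in> carrier_vec k" "x = transpose_mat (Q * H) *\<^sub>v a"
    using Q by (auto simp: row_combs_def)
  then have "x = transpose_mat H *\<^sub>v (transpose_mat Q *\<^sub>v a)"
    using Q H by (simp add: transpose_mult[OF Q H] assoc_mult_mat_vec[of _ n m _ k])
  moreover have "transpose_mat Q *\<^sub>v a \<in> carrier_vec (dim_row H)"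
    using Q H a by auto
  ultimately show "x \<in> row_combs H" using row_combsI by blast
qed

section \<open>LCD codes and Gram matrices\<close>

lemma ex1_implies_eq: "\<exists>!x. P x \<Longrightarrow> P a \<Longrightarrow> P b \<Longrightarrow> a = b"
  by blast

text \<open>Orthogonality to the rows extends to all codewords since the dot product of
  \<open>x\<close> with \<open>a H\<close> equals that of \<open>a\<close> with \<open>H x\<close>;
  conversely each row is itself a codeword.\<close>

lemma dual_code_row_combs:
  fixes H :: "'a::comm_ring_1 dual_num mat"
  assumes H: "H \<in> carrier_mat k N"
  shows "x \<in> dual_code N (row_combs H) \<longleftrightarrow> x \<in> carrier_vec N \<and> H *\<^sub>v x = 0\<^sub>v k"
proof (cases "x \<in> carrier_vec N")
  case x: True
  have T: "transpose_mat H \<in> carrier_mat N k" using H by simp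
  have "x \<bullet> (transpose_mat H *\<^sub>v a) = a \<bullet> (H *\<^sub>v x)" if a: "a \<in> carrier_vec k" for a
    using transpose_vec_mult_scalar[OF H x a] comm_scalar_prod[OF x mult_mat_vec_carrier[OF T a]]
    by simp
  then have "x \<in> dual_code N (row_combs H)" if "H *\<^sub>v x = 0\<^sub>v k"
    using that x H by (auto simp: dual_code_def row_combs_def)
  moreover have "H *\<^sub>v x = 0\<^sub>v k" if xD: "x \<in> dual_code N (row_combs H)"
  proof (rule eq_vecI)
    fix i assume "i < dim_vec (0\<^sub>v k :: 'a dual_num vec)"
    then have i: "i < k" by simp
    have "(H *\<^sub>v x) $ i = x \<bullet> row H i"
      using i H x by (auto intro: comm_scalar_prod[of _ N])
    moreover have "row H i \<in> row_combs H"
      using i H by (auto intro: row_in_row_combs)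
    ultimately show "(H *\<^sub>v x) $ i = 0\<^sub>v k $ i"
      using i xD by (simp add: dual_code_def)
  qed (use H in simp)
  ultimately show ?thesis using x by blast
qed (simp add: dual_code_def)

text \<open>Let \<open>M\<close> be the residue of \<open>H H\<^sup>T\<close>. If \<open>M y = 0\<close>, then \<open>u y H\<close> is orthogonal to the
  whole code, so \<open>y H\<close> vanishes modulo \<open>u\<close>, say \<open>y H = u w\<close>. The residue of \<open>H w\<close> lies in the
  column space of \<open>M\<close>, because \<open>ker M\<close> annihilates it. Subtracting the corresponding codeword
  multiple \<open>u a H\<close> from \<open>y H\<close> leaves a self-orthogonal codeword, which is \<open>0\<close>.\<close>

lemma lcd_imp_inj_gram:
  fixes H :: "'a::field dual_num mat"
  assumes H: "H \<in> carrier_mat k N"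
    and lcd: "row_combs H \<inter> dual_code N (row_combs H) \<subseteq> {0\<^sub>v N}"
    and indep: "\<And>a. a \<in> carrier_vec k \<Longrightarrow> transpose_mat H *\<^sub>v a = 0\<^sub>v N \<Longrightarrow> map_vec res a = 0\<^sub>v k"
  shows "inj_mat (map_mat res (H * transpose_mat H))"
proof -
  define T where "T = transpose_mat H"
  define M where "M = map_mat res (H * T)"
  define H0 where "H0 = map_mat res H"
  have T: "T \<in> carrier_mat N k" and M: "M \<in> carrier_mat k k" and H0: "H0 \<in> carrier_mat k N"
    using H by (auto simp: T_def M_def H0_def)
  have HT: "H * T \<in> carrier_mat k k" using H T by simp
  have MT: "transpose_mat M = M"
    using transpose_mult[OF H T] by (simp add: M_def T_def map_mat_transpose)
  have res_HT: "map_vec res (H *\<^sub>v (T *\<^sub>v map_vec emb y)) = M *\<^sub>v y" if "y \<in> carrier_vec k" for y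
    using that assoc_mult_mat_vec[OF H T, of "map_vec emb y"]
      res_hom.mult_mat_vec_hom[OF HT, of "map_vec emb y"] by (simp add: M_def)
  have res_T: "map_vec res (T *\<^sub>v map_vec emb y) = transpose_mat H0 *\<^sub>v y"
    if "y \<in> carrier_vec k" for y
    using that res_hom.mult_mat_vec_hom[OF T, of "map_vec emb y"]
    by (simp add: H0_def T_def map_mat_transpose)
  \<comment> \<open>This is where the LCD property enters: a codeword orthogonal to all rows is
    zero.\<close>
  have self_orth: "T *\<^sub>v a = 0\<^sub>v N"
    if "a \<in> carrier_vec k" "H *\<^sub>v (T *\<^sub>v a) = 0\<^sub>v k" for a
  proof -
    have "T *\<^sub>v a \<in> dual_code N (row_combs H)"
      using that T by (simp add: dual_code_row_combs[OF H])
    moreover have "T *\<^sub>v a \<in> row_combs H"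
      using that(1) H row_combsI[of a H] by (simp add: T_def)
    ultimately show ?thesis using lcd by blast
  qed
  have ker_T: "transpose_mat H0 *\<^sub>v y = 0\<^sub>v N" if y: "y \<in> carrier_vec k" "M *\<^sub>v y = 0\<^sub>v k" for y
  proof -
    define v where "v = T *\<^sub>v map_vec emb y"
    have v: "v \<in> carrier_vec N" using T y by (simp add: v_def)
    have Tu: "T *\<^sub>v (u \<cdot>\<^sub>v map_vec emb y) = u \<cdot>\<^sub>v v"
      unfolding v_def using y by (intro mult_mat_vec_smult[OF T]) simp
    have "H *\<^sub>v (u \<cdot>\<^sub>v v) = u \<cdot>\<^sub>v (H *\<^sub>v v)" by (rule mult_mat_vec_smult[OF H v])
    also have "\<dots> = 0\<^sub>v k"
      using smult_u_eq_0_iff[of "H *\<^sub>v v"] res_HT[OF y(1)] y(2) H by (simp add: v_def)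
    finally have "u \<cdot>\<^sub>v v = 0\<^sub>v N"
      using self_orth[of "u \<cdot>\<^sub>v map_vec emb y"] y Tu by simp
    then have "map_vec res v = 0\<^sub>v N" using smult_u_eq_0_iff[of v] v by simp
    then show ?thesis using res_T[OF y(1)] by (simp add: v_def)
  qed
  show ?thesis
  proof (rule inj_matI)
    fix y assume y: "y \<in> carrier_vec k"
      and My: "map_mat res (H * transpose_mat H) *\<^sub>v y = 0\<^sub>v k"
    have My: "M *\<^sub>v y = 0\<^sub>v k" using My by (simp add: M_def T_def)
    define v where "v = T *\<^sub>v map_vec emb y"
    have v: "v \<in> carrier_vec N" using T y by (simp add: v_def)
    have "map_vec res v = 0\<^sub>v N" using ker_T[OF y My] res_T[OF y] by (simp add: v_def)
    define w where "w = map_vec upart v"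
    have w: "w \<in> carrier_vec N" using v by (simp add: w_def)
    have vw: "v = u \<cdot>\<^sub>v map_vec emb w"
      unfolding w_def by (rule map_vec_res_eq_0D) fact+
    \<comment> \<open>Moving \<open>H0\<close> across the dot product reduces the claim to
      \<open>ker_T\<close>. Symmetry of \<open>M\<close> then identifies its row space with its
      column space, which yields \<open>a\<close>.\<close>
    have "x \<bullet> (H0 *\<^sub>v w) = 0" if x: "x \<in> carrier_vec k" "M *\<^sub>v x = 0\<^sub>v k" for x
      using transpose_vec_mult_scalar[OF H0 w x(1)] ker_T[OF x] w by simp
    then obtain a where a: "a \<in> carrier_vec k" "H0 *\<^sub>v w = M *\<^sub>v a"
      using row_space_of_orthogonal[OF M, of "H0 *\<^sub>v w"] H0 w MT by (metis mult_mat_vec_carrier)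
    define a' where "a' = map_vec emb a"
    define y' where "y' = map_vec emb y"
    have a': "a' \<in> carrier_vec k" and y': "y' \<in> carrier_vec k" and w': "map_vec emb w \<in> carrier_vec N"
      using a y w by (simp_all add: a'_def y'_def)
    have Ta': "T *\<^sub>v a' \<in> carrier_vec N" using T a' by simp
    \<comment> \<open>Here \<open>u z\<close> is the codeword \<open>y H - u a H\<close>. The choice
      of \<open>a\<close> makes \<open>H z\<close> vanish modulo \<open>u\<close>, so
      \<open>u z\<close> is orthogonal to the code.\<close>
    define z where "z = map_vec emb w - T *\<^sub>v a'"
    have z: "z \<in> carrier_vec N" using w' Ta' by (simp add: z_def)
    have "T *\<^sub>v (y' - u \<cdot>\<^sub>v a') = u \<cdot>\<^sub>v map_vec emb w - u \<cdot>\<^sub>v (T *\<^sub>v a')"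
      using mult_minus_distrib_mat_vec[OF T y', of "u \<cdot>\<^sub>v a'"] a' mult_mat_vec_smult[OF T a', of u] vw
      by (simp add: v_def y'_def)
    also have "\<dots> = u \<cdot>\<^sub>v z"
      using w' Ta' carrier_matD[OF T] by (intro eq_vecI) (simp_all add: z_def right_diff_distrib)
    finally have Tz: "T *\<^sub>v (y' - u \<cdot>\<^sub>v a') = u \<cdot>\<^sub>v z" .
    have "map_vec res (H *\<^sub>v z) = map_vec res (H *\<^sub>v map_vec emb w) - map_vec res (H *\<^sub>v (T *\<^sub>v a'))"
      unfolding z_def mult_minus_distrib_mat_vec[OF H w' Ta']
      by (rule map_vec_res_minus) simp
    also have "map_vec res (H *\<^sub>v map_vec emb w) = M *\<^sub>v a"
      using res_hom.mult_mat_vec_hom[OF H w'] a(2) by (simp add: H0_def)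
    also have "map_vec res (H *\<^sub>v (T *\<^sub>v a')) = M *\<^sub>v a"
      using res_HT[OF a(1)] by (simp add: a'_def)
    finally have "map_vec res (H *\<^sub>v z) = 0\<^sub>v k"
      using M a by (intro eq_vecI) simp_all
    then have "H *\<^sub>v (u \<cdot>\<^sub>v z) = 0\<^sub>v k"
      using mult_mat_vec_smult[OF H z, of u] smult_u_eq_0_iff[of "H *\<^sub>v z"] H by simp
    then have "T *\<^sub>v (y' - u \<cdot>\<^sub>v a') = 0\<^sub>v N"
      using self_orth[of "y' - u \<cdot>\<^sub>v a'"] a' y' Tz by simp
    \<comment> \<open>The correction \<open>u a\<close> is invisible modulo \<open>u\<close>, so the
      relation obtained forces \<open>y\<close> itself to vanish.\<close>
    then have "map_vec res (y' - u \<cdot>\<^sub>v a') = 0\<^sub>v k"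
      using indep[of "y' - u \<cdot>\<^sub>v a'"] a' y' by (simp add: T_def)
    moreover have "map_vec res (y' - u \<cdot>\<^sub>v a') = y"
      using y a' by (intro eq_vecI) (simp_all add: y'_def)
    ultimately show "y = 0\<^sub>v k" by simp
  qed (use H in simp)
qed

text \<open>A codeword \<open>a H\<close> that is orthogonal to the code satisfies
  \<open>H H^T a = 0\<close>, so \<open>a = 0\<close>.\<close>

lemma inj_gram_imp_lcd:
  assumes H: "H \<in> carrier_mat k N" and inj: "inj_mat (H * transpose_mat H)"
  shows "lcd_code N (row_combs H)"
proof -
  have T: "transpose_mat H \<in> carrier_mat N k" using H by simp
  have lin: "linear_code N (row_combs H)" using H by (intro linear_code_row_combs) simp
  then have 0: "0\<^sub>v N \<in> row_combs H"
    by (simp add: linear_code_def submodule_def module_vec_simps)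
  have "x = 0\<^sub>v N" if xC: "x \<in> row_combs H" and xD: "x \<in> dual_code N (row_combs H)" for x
  proof -
    obtain a where a: "a \<in> carrier_vec k" "x = transpose_mat H *\<^sub>v a"
      using xC H by (auto simp: row_combs_def)
    have "H * transpose_mat H *\<^sub>v a = 0\<^sub>v k"
      using xD a assoc_mult_mat_vec[OF H T a(1)] by (simp add: dual_code_row_combs[OF H])
    then have "a = 0\<^sub>v k" using inj_matD[OF inj _ a(1)] H by simp
    then show ?thesis using a mult_mat_zero_vec[OF T] by simp
  qed
  moreover have "0\<^sub>v N \<in> dual_code N (row_combs H)"
    using mult_mat_zero_vec[OF H] by (simp add: dual_code_row_combs[OF H])
  ultimately show ?thesis using lin 0 unfolding lcd_code_def by blast
qed

section \<open>Generator matrices\<close>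

lemma generator_matrix_code:
  assumes "generator_matrix n C G"
  shows "C = row_combs G"
proof
  show "C \<subseteq> row_combs G"
  proof
    fix c assume "c \<in> C"
    moreover obtain k1 where "\<forall>c\<in>C. \<exists>!a. a \<in> carrier_vec (dim_row G) \<and>
        (\<forall>i. k1 \<le> i \<and> i < dim_row G \<longrightarrow> a $ i \<in> range emb) \<and> c = transpose_mat G *\<^sub>v a"
      using assms unfolding generator_matrix_def by blast
    ultimately show "c \<in> row_combs G" unfolding row_combs_def by blast
  qed
  show "row_combs G \<subseteq> C"
    using assms by (intro row_combs_subset) (auto simp: generator_matrix_def linear_code_def)
qed

text \<open>Rows in \<open>(uR)^n\<close> are killed by \<open>u\<close>, so full independence over
  \<open>R\<close> may fail, but every relation has coefficients in \<open>uR\<close>. The relation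
  is normalised to admissible coefficients and compared with the zero representation of the zero
  codeword.\<close>

lemma generator_matrix_indep:
  fixes G :: "'a::field dual_num mat"
  assumes G: "generator_matrix n C G" "dim_row G = k"
    and a: "a \<in> carrier_vec k" "transpose_mat G *\<^sub>v a = 0\<^sub>v n"
  shows "map_vec res a = 0\<^sub>v k"
proof -
  have n: "dim_col G = n" using G by (simp add: generator_matrix_def)
  obtain k1 where k1: "\<forall>i. k1 \<le> i \<and> i < k \<longrightarrow> row G i \<in> uR_vecs n"
    and uniq: "\<forall>c\<in>C. \<exists>!a. a \<in> carrier_vec k \<and>
      (\<forall>i. k1 \<le> i \<and> i < k \<longrightarrow> a $ i \<in> range emb) \<and> c = transpose_mat G *\<^sub>v a"
    using G(1) unfolding generator_matrix_def G(2) by blast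
  have T: "transpose_mat G \<in> carrier_mat n k" using G n by auto
  have GT0: "transpose_mat G *\<^sub>v 0\<^sub>v k = 0\<^sub>v n" by (rule mult_mat_zero_vec[OF T])
  have 0: "0\<^sub>v n \<in> C"
    using G by (simp add: generator_matrix_def linear_code_def submodule_def module_vec_simps)
  \<comment> \<open>From index \<open>k1\<close> on, coefficients are replaced by their residues.
    The rows there have entries in \<open>uR\<close>, and \<open>u^2 = 0\<close>, so the combination
    is unchanged.\<close>
  define b where "b = vec k (\<lambda>i. if k1 \<le> i then emb (res (a $ i)) else a $ i)"
  have "transpose_mat G *\<^sub>v b = transpose_mat G *\<^sub>v a"
  proof (rule eq_vecI)
    fix j assume "j < dim_vec (transpose_mat G *\<^sub>v a)"
    then have j: "j < n" using n by simp
    have "G $$ (i, j) * b $ i = G $$ (i, j) * a $ i" if i: "i < k" for i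
    proof (cases "k1 \<le> i")
      case True
      then have "map_vec res (row G i) = 0\<^sub>v n" using k1 True i by (simp add: uR_vecs_iff)
      then have "res (G $$ (i, j)) = 0"
        using i j G n by (metis index_map_vec(1) index_row(1) index_row(2) index_zero_vec(1))
      then show ?thesis using i True by (simp add: b_def dual_num_eq_iff)
    qed (use i in \<open>simp add: b_def\<close>)
    then show "(transpose_mat G *\<^sub>v b) $ j = (transpose_mat G *\<^sub>v a) $ j"
      using j n G(2) a(1) by (auto simp: scalar_prod_def b_def)
  qed simp
  with a have "b \<in> carrier_vec k \<and> (\<forall>i. k1 \<le> i \<and> i < k \<longrightarrow> b $ i \<in> range emb) \<and>
      0\<^sub>v n = transpose_mat G *\<^sub>v b"
    by (simp add: b_def)
  moreover have "(0\<^sub>v k :: 'a dual_num vec) \<in> carrier_vec k \<and>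
      (\<forall>i. k1 \<le> i \<and> i < k \<longrightarrow> (0\<^sub>v k :: 'a dual_num vec) $ i \<in> range emb) \<and>
      0\<^sub>v n = transpose_mat G *\<^sub>v 0\<^sub>v k"
    using GT0 by (simp add: range_emb)
  ultimately have b0: "b = 0\<^sub>v k" by (rule ex1_implies_eq[OF bspec[OF uniq 0]])
  show ?thesis
  proof (rule eq_vecI)
    fix i assume "i < dim_vec (0\<^sub>v k :: 'a vec)"
    then have i: "i < k" by simp
    have "res (b $ i) = res (a $ i)" using i by (simp add: b_def)
    then show "map_vec res a $ i = 0\<^sub>v k $ i" using b0 i a by simp
  qed (use a in simp)
qed

text \<open>Each row of \<open>X - 1\<close> is a relation among the rows of \<open>G\<close>, so
  its entries vanish modulo \<open>u\<close>.\<close>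

lemma generator_matrix_fix_left:
  fixes G :: "'a::field dual_num mat"
  assumes gen: "generator_matrix n C G" and G: "G \<in> carrier_mat k n"
    and X: "X \<in> carrier_mat k k" "X * G = G"
  shows "map_mat res X = 1\<^sub>m k"
proof (rule eq_rowI)
  fix i assume "i < dim_row (1\<^sub>m k :: 'a mat)"
  then have i: "i < k" by simp
  have T: "transpose_mat G \<in> carrier_mat n k" using G by simp
  have rX: "row X i \<in> carrier_vec k" using X by auto
  have "transpose_mat G *\<^sub>v (row X i - unit_vec k i)
      = transpose_mat G *\<^sub>v row X i - transpose_mat G *\<^sub>v unit_vec k i"
    by (rule mult_minus_distrib_mat_vec[OF T rX]) simp
  also have "transpose_mat G *\<^sub>v row X i = row G i"
    using row_mult_mat[OF X(1) G i] X(2) by simp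
  also have "transpose_mat G *\<^sub>v unit_vec k i = row G i"
    using G i by (intro eq_vecI) auto
  also have "row G i - row G i = 0\<^sub>v n" using G by (intro eq_vecI) auto
  finally have "map_vec res (row X i - unit_vec k i) = 0\<^sub>v k"
    using generator_matrix_indep[OF gen, of k "row X i - unit_vec k i"] G rX by simp
  then have "res (X $$ (i, j)) = (if j = i then 1 else 0)" if "j < k" for j
    using that i X(1) arg_cong[of _ _ "\<lambda>v. v $ j"] by (auto simp: vec_eq_iff unit_vec_def)
  then show "row (map_mat res X) i = row (1\<^sub>m k) i"
    using X i by (intro eq_vecI) auto
qed (use X in auto)

text \<open>Each matrix factors through the other, and the residues of the two factors are mutually
  inverse. Hence the row numbers agree and \<open>Q\<close> is invertible over \<open>R\<close> by
  lifting.\<close>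

lemma generator_matrix_unique:
  fixes G :: "'a::{field, finite} dual_num mat"
  assumes gen: "generator_matrix n C G" "generator_matrix n C G'"
  obtains k Q Q' where "G \<in> carrier_mat k n" "G' \<in> carrier_mat k n"
    "Q \<in> carrier_mat k k" "Q' \<in> carrier_mat k k" "Q * Q' = 1\<^sub>m k" "Q' * Q = 1\<^sub>m k" "G = Q * G'"
proof -
  define k m where "k = dim_row G" and "m = dim_row G'"
  have G: "G \<in> carrier_mat k n" and G': "G' \<in> carrier_mat m n"
    using gen by (auto simp: k_def m_def generator_matrix_def)
  have "C = row_combs G" "C = row_combs G'" "set (rows G) \<subseteq> C" "set (rows G') \<subseteq> C"
    using gen generator_matrix_code[OF gen(1)] generator_matrix_code[OF gen(2)]
    by (simp_all only: generator_matrix_def)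
  then have "set (rows G) \<subseteq> row_combs G'" "set (rows G') \<subseteq> row_combs G" by simp_all
  then obtain P Q where Q: "Q \<in> carrier_mat k m" "G = Q * G'" and P: "P \<in> carrier_mat m k" "G' = P * G"
    using rows_in_row_combs_factor[OF G G'] rows_in_row_combs_factor[OF G' G] by metis
  have "Q * P * G = G" using assoc_mult_mat[OF Q(1) P(1) G] by (simp only: flip: Q(2) P(2))
  then have QP: "map_mat res Q * map_mat res P = 1\<^sub>m k"
    using generator_matrix_fix_left[OF gen(1) G, of "Q * P"] Q(1) P(1)
    by (simp add: res_hom.mat_hom_mult[OF Q(1) P(1)])
  have "P * Q * G' = G'" using assoc_mult_mat[OF P(1) Q(1) G'] by (simp only: flip: Q(2) P(2))
  then have PQ: "map_mat res P * map_mat res Q = 1\<^sub>m m"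
    using generator_matrix_fix_left[OF gen(2) G', of "P * Q"] Q(1) P(1)
    by (simp add: res_hom.mat_hom_mult[OF P(1) Q(1)])
  have injQ: "inj_mat (map_mat res Q)" and injP: "inj_mat (map_mat res P)"
    using inj_mat_leftI[OF _ _ PQ, of k] inj_mat_leftI[OF _ _ QP, of m] P(1) Q(1) by auto
  have "m = k"
    using inj_mat_dim_le[OF injQ, of k m] inj_mat_dim_le[OF injP, of m k] P(1) Q(1) by auto
  with Q(1) have Qk: "Q \<in> carrier_mat k k" by simp
  \<comment> \<open>A genuine inverse over \<open>R\<close> is taken here, because \<open>P\<close>
    is known to invert \<open>Q\<close> only modulo \<open>u\<close>.\<close>
  obtain Q' where Q': "Q' \<in> carrier_mat k k" "Q * Q' = 1\<^sub>m k" "Q' * Q = 1\<^sub>m k"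
    using inj_mat_inverse[OF inj_mat_res_lift[OF injQ] Qk] .
  show ?thesis by (rule that[OF G _ Qk Q' Q(2)]) (use G' \<open>m = k\<close> in simp)
qed

section \<open>Embeddings\<close>

lemma append_cols_dim [simp]:
  "dim_row (append_cols A B) = dim_row A" "dim_col (append_cols A B) = dim_col A + dim_col B"
  by (simp_all add: append_cols_def)

lemma append_cols_carrier:
  assumes "A \<in> carrier_mat k n" "B \<in> carrier_mat k m"
  shows "append_cols A B \<in> carrier_mat k (n + m)"
  using assms by auto

lemma append_cols_index:
  assumes "A \<in> carrier_mat k n" "B \<in> carrier_mat k m" "i < k" "j < n + m"
  shows "append_cols A B $$ (i, j) = (if j < n then A $$ (i, j) else B $$ (i, j - n))"
  using assms by (auto simp: append_cols_def)

lemma row_append_cols: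
  assumes A: "A \<in> carrier_mat k n" and B: "B \<in> carrier_mat k m" and i: "i < k"
  shows "row (append_cols A B) i = row A i @\<^sub>v row B i"
  using append_cols_carrier[OF A B] append_cols_index[OF A B i] A B i
  by (intro eq_vecI) auto

lemma mult_append_cols:
  assumes Q: "Q \<in> carrier_mat r k" and A: "A \<in> carrier_mat k n" and B: "B \<in> carrier_mat k m"
  shows "Q * append_cols A B = append_cols (Q * A) (Q * B)"
proof (rule eq_matI)
  have QA: "Q * A \<in> carrier_mat r n" and QB: "Q * B \<in> carrier_mat r m"
    using Q A B by auto
  note H = append_cols_carrier[OF A B] append_cols_carrier[OF QA QB]
  then show "dim_row (Q * append_cols A B) = dim_row (append_cols (Q * A) (Q * B))"
    "dim_col (Q * append_cols A B) = dim_col (append_cols (Q * A) (Q * B))"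
    using Q by auto
  fix i j assume "i < dim_row (append_cols (Q * A) (Q * B))" "j < dim_col (append_cols (Q * A) (Q * B))"
  then have ij: "i < r" "j < n + m" using H by auto
  have "col (append_cols A B) j = (if j < n then col A j else col B (j - n))"
    using ij H A B append_cols_index[OF A B] by (intro eq_vecI) auto
  then show "(Q * append_cols A B) $$ (i, j) = append_cols (Q * A) (Q * B) $$ (i, j)"
    using ij H Q A B by (auto simp: append_cols_index[OF QA QB])
qed

text \<open>A relation among the rows of \<open>[A | B]\<close> restricts to one among the rows of
  \<open>A\<close>, which carries the independence modulo \<open>u\<close> from \<open>G\<close> to
  its extensions.\<close>

lemma transpose_append_cols_mult:
  assumes A: "A \<in> carrier_mat k n" and B: "B \<in> carrier_mat k m" and a: "a \<in> carrier_vec k"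
    and 0: "transpose_mat (append_cols A B) *\<^sub>v a = 0\<^sub>v (n + m)"
  shows "transpose_mat A *\<^sub>v a = 0\<^sub>v n"
proof (rule eq_vecI)
  fix j assume "j < dim_vec (0\<^sub>v n)"
  then have j: "j < n" by simp
  note H = append_cols_carrier[OF A B]
  have "col (append_cols A B) j = col A j"
    using j H A B append_cols_index[OF A B] by (intro eq_vecI) auto
  then show "(transpose_mat A *\<^sub>v a) $ j = 0\<^sub>v n $ j"
    using arg_cong[OF 0, of "\<lambda>v. v $ j"] j H A by simp
qed (use A in simp)

lemma gram_append_cols:
  assumes A: "A \<in> carrier_mat k n" and B: "B \<in> carrier_mat k m"
  shows "append_cols A B * transpose_mat (append_cols A B)
    = A * transpose_mat A + B * transpose_mat B"
proof (rule eq_matI)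
  note H = append_cols_carrier[OF A B]
  fix i j assume "i < dim_row (A * transpose_mat A + B * transpose_mat B)"
    "j < dim_col (A * transpose_mat A + B * transpose_mat B)"
  then have "i < k" "j < k" using A B by auto
  then show "(append_cols A B * transpose_mat (append_cols A B)) $$ (i, j)
      = (A * transpose_mat A + B * transpose_mat B) $$ (i, j)"
    using H A B row_append_cols[OF A B] scalar_prod_append[of "row A i" n "row B i" m "row A j" "row B j"]
    by simp
qed (use append_cols_carrier[OF A B] A B in auto)

text \<open>The code is free on the rows of \<open>H\<close>. A row in \<open>(uR)^N\<close> would
  put a unit vector into the kernel of the residue Gram matrix, and injectivity of
  \<open>H H^T\<close> makes coefficients unique.\<close>

lemma inj_gram_imp_generator_matrix:
  fixes H :: "'a::field dual_num mat"
  assumes H: "H \<in> carrier_mat k N" and inj: "inj_mat (map_mat res (H * transpose_mat H))"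
  shows "generator_matrix N (row_combs H) H"
proof -
  have T: "transpose_mat H \<in> carrier_mat N k" using H by simp
  have HT: "H * transpose_mat H \<in> carrier_mat k k" using H by simp
  have not_uR: "row H i \<notin> uR_vecs N" if i: "i < k" for i
  proof
    assume "row H i \<in> uR_vecs N"
    then have 0: "map_vec res (row H i) = 0\<^sub>v N" by (simp add: uR_vecs_iff)
    have row: "row H i = transpose_mat H *\<^sub>v unit_vec k i"
      using H i by (intro eq_vecI) auto
    have "map_mat res (H * transpose_mat H) *\<^sub>v map_vec res (unit_vec k i)
        = map_vec res (H * transpose_mat H *\<^sub>v unit_vec k i)"
      by (rule res_hom.mult_mat_vec_hom[OF HT, symmetric]) simp
    also have "H * transpose_mat H *\<^sub>v unit_vec k i = H *\<^sub>v row H i"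
      unfolding row by (rule assoc_mult_mat_vec[OF H T]) simp
    also have "map_vec res (H *\<^sub>v row H i) = map_mat res H *\<^sub>v map_vec res (row H i)"
      using H by (intro res_hom.mult_mat_vec_hom[OF H]) auto
    also have "\<dots> = 0\<^sub>v k"
      unfolding 0 using H by (intro mult_mat_zero_vec) simp
    finally have "map_vec res (unit_vec k i) = (0\<^sub>v k :: 'a vec)"
      using HT inj_matD[OF inj, of k k] by simp
    from arg_cong[OF this, of "\<lambda>v. v $ i"] show False using i by simp
  qed
  have uniq: "a = b" if ab: "a \<in> carrier_vec k" "b \<in> carrier_vec k"
    "transpose_mat H *\<^sub>v a = transpose_mat H *\<^sub>v b" for a b
  proof (rule inj_onD[OF inj_mat_inj_on[OF inj_mat_res_lift[OF inj] HT]])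
    show "H * transpose_mat H *\<^sub>v a = H * transpose_mat H *\<^sub>v b"
      using assoc_mult_mat_vec[OF H T ab(1)] assoc_mult_mat_vec[OF H T ab(2)] ab(3) by simp
  qed (use ab in auto)
  have dims: "dim_row H = k" "dim_col H = N" using H by auto
  show ?thesis
    unfolding generator_matrix_def dims
  \<comment> \<open>The witness \<open>k1 = k\<close> lets all coefficients range over
    \<open>R\<close>, leaving no rows of the second kind.\<close>
  proof (intro conjI exI[of _ k] allI impI ballI)
    show "linear_code N (row_combs H)" by (rule linear_code_row_combs[OF dims(2)])
    show "set (rows H) \<subseteq> row_combs H"
      using row_in_row_combs[of _ H] by (auto simp: rows_def)
    show "row H i \<notin> uR_vecs N" if "i < k" for i by (rule not_uR[OF that])
    show "row H i \<in> uR_vecs N" if "k \<le> i \<and> i < k" for i using that by linarith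
    fix c assume "c \<in> row_combs H"
    then obtain a where a: "a \<in> carrier_vec k" "c = transpose_mat H *\<^sub>v a"
      using dims by (auto simp: row_combs_def)
    show "\<exists>!a. a \<in> carrier_vec k \<and> (\<forall>i. k \<le> i \<and> i < k \<longrightarrow> a $ i \<in> range emb)
        \<and> c = transpose_mat H *\<^sub>v a"
    proof (intro ex1I[of _ a] conjI allI impI)
      show "a $ i \<in> range emb" if "k \<le> i \<and> i < k" for i using that by linarith
      show "b = a" if "b \<in> carrier_vec k \<and> (\<forall>i. k \<le> i \<and> i < k \<longrightarrow> b $ i \<in> range emb)
        \<and> c = transpose_mat H *\<^sub>v b" for b
        using uniq[of b a] a that by metis
    qed fact+
  qed simp_all
qed

text \<open>Freeness of the extended code is not presupposed: the relations among the rows of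
  \<open>G\<close> supply the independence modulo \<open>u\<close> that the forward direction
  uses.\<close>

lemma lcd_append_cols_iff:
  fixes G :: "'a::field dual_num mat"
  assumes gen: "generator_matrix n C G" and G: "G \<in> carrier_mat k n" and B: "B \<in> carrier_mat k m"
  shows "lcd_code (n + m) (row_combs (append_cols G B)) \<longleftrightarrow>
    inj_mat (map_mat res (G * transpose_mat G + B * transpose_mat B))"
proof -
  note H = append_cols_carrier[OF G B]
  have "map_vec res a = 0\<^sub>v k"
    if "a \<in> carrier_vec k" "transpose_mat (append_cols G B) *\<^sub>v a = 0\<^sub>v (n + m)" for a
    using G by (intro generator_matrix_indep[OF gen _ that(1) transpose_append_cols_mult[OF G B that]]) simp
  note indep = this
  have "inj_mat (map_mat res (append_cols G B * transpose_mat (append_cols G B)))"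
    if "lcd_code (n + m) (row_combs (append_cols G B))"
    by (rule lcd_imp_inj_gram[OF H _ indep]) (use that in \<open>simp_all add: lcd_code_def\<close>)
  then show ?thesis
    using inj_gram_imp_lcd[OF H] inj_mat_res_lift unfolding gram_append_cols[OF G B] by blast
qed

text \<open>An embedding may start from any generator matrix \<open>G'\<close> of the code. Writing
  \<open>G = Q G'\<close> with \<open>Q\<close> invertible, \<open>[G | Q B'] = Q [G' | B']\<close>
  has the same row space as \<open>[G' | B']\<close>.\<close>

lemma lcd_embedding_iff:
  fixes G :: "'a::{field, finite} dual_num mat"
  assumes gen: "generator_matrix n C G" and G: "G \<in> carrier_mat k n"
  shows "lcd_embedding n C N D \<longleftrightarrow> (\<exists>m B. B \<in> carrier_mat k m \<and> N = n + m \<and>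
    D = row_combs (append_cols G B) \<and> inj_mat (map_mat res (G * transpose_mat G + B * transpose_mat B)))"
    (is "?L \<longleftrightarrow> ?R")
proof
  assume ?L
  then obtain G' B' where gen': "generator_matrix n C G'" and B': "dim_row B' = dim_row G'"
    and N: "N = n + dim_col B'" and lcd: "lcd_code N D"
    and D: "D = LinearCombinations.module.span class_ring (module_vec TYPE('a dual_num) N)
      (set (rows (append_cols G' B')))"
    unfolding lcd_embedding_def by blast
  obtain k' Q Q' where G0: "G \<in> carrier_mat k' n" and G': "G' \<in> carrier_mat k' n"
    and Q: "Q \<in> carrier_mat k' k'" "Q' \<in> carrier_mat k' k'" "Q' * Q = 1\<^sub>m k'" and GQ: "G = Q * G'"
    using generator_matrix_unique[OF gen gen'] by metis
  have k': "k' = k" using G G0 by auto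
  define m where "m = dim_col B'"
  have B'c: "B' \<in> carrier_mat k m" using B' G' k' by (auto simp: m_def)
  note c = Q(1,2)[unfolded k'] G'[unfolded k']
  define B where "B = Q * B'"
  have B: "B \<in> carrier_mat k m" using B'c c by (simp add: B_def)
  note H = append_cols_carrier[OF G B] and H' = append_cols_carrier[OF c(3) B'c]
  have QH: "Q * append_cols G' B' = append_cols G B"
    using mult_append_cols[OF c(1,3) B'c] by (simp add: B_def GQ)
  have "Q' * append_cols G B = append_cols G' B'"
    using assoc_mult_mat[OF c(2,1) H'] Q(3) left_mult_one_mat[OF H'] unfolding QH k' by simp
  then have "row_combs (append_cols G' B') = row_combs (append_cols G B)"
    using row_combs_mult_subset[OF c(1) H'] row_combs_mult_subset[OF c(2) H] QH by auto
  then have D': "D = row_combs (append_cols G B)"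
    using D span_rows[of "append_cols G' B'" N] G' N by simp
  then show ?R
    using lcd lcd_append_cols_iff[OF gen G B] B N by (auto simp: m_def)
next
  assume ?R
  then obtain m B where B: "B \<in> carrier_mat k m" and N: "N = n + m"
    and D: "D = row_combs (append_cols G B)"
    and inj: "inj_mat (map_mat res (G * transpose_mat G + B * transpose_mat B))"
    by blast
  have "D = LinearCombinations.module.span class_ring (module_vec TYPE('a dual_num) N)
      (set (rows (append_cols G B)))"
    using span_rows[of "append_cols G B" N] G B N D by simp
  moreover have "lcd_code N D"
    using lcd_append_cols_iff[OF gen G B] inj N D by simp
  ultimately show ?L
    using gen G B N unfolding lcd_embedding_def by auto
qed

section \<open>Blocks of rows\<close>

definition top_rows :: "nat \<Rightarrow> 'a mat \<Rightarrow> 'a mat" where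
  "top_rows l A = mat l (dim_col A) (\<lambda>(i, j). A $$ (i, j))"

lemma top_rows_carrier [simp]: "A \<in> carrier_mat k n \<Longrightarrow> top_rows l A \<in> carrier_mat l n"
  by (auto simp: top_rows_def)

lemma top_rows_mult:
  fixes A B :: "'a::comm_ring_1 mat"
  assumes "A \<in> carrier_mat k n" "B \<in> carrier_mat n m" "l \<le> k"
  shows "top_rows l A * B = top_rows l (A * B)"
proof (rule eq_matI)
  fix i j assume "i < dim_row (top_rows l (A * B))" "j < dim_col (top_rows l (A * B))"
  then have ij: "i < l" "j < m" using assms by (auto simp: top_rows_def)
  have "row (top_rows l A) i = row A i"
    using ij assms by (intro eq_vecI) (auto simp: top_rows_def)
  then show "(top_rows l A * B) $$ (i, j) = top_rows l (A * B) $$ (i, j)"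
    using ij assms by (auto simp: top_rows_def)
qed (use assms in \<open>auto simp: top_rows_def\<close>)

lemma top_rows_append_rows:
  assumes "A \<in> carrier_mat l n" "B \<in> carrier_mat r n"
  shows "top_rows l (A @\<^sub>r B) = A"
  using assms by (intro eq_matI) (auto simp: top_rows_def append_rows_def)

lemma append_rows_split:
  assumes "A \<in> carrier_mat k n" "l \<le> k"
  obtains B where "B \<in> carrier_mat (k - l) n" "A = top_rows l A @\<^sub>r B"
proof
  show "mat (k - l) n (\<lambda>(i, j). A $$ (i + l, j)) \<in> carrier_mat (k - l) n" by simp
  show "A = top_rows l A @\<^sub>r mat (k - l) n (\<lambda>(i, j). A $$ (i + l, j))"
    using assms by (intro eq_matI) (auto simp: top_rows_def append_rows_def)
qed

lemma map_mat_top_rows: "l \<le> dim_row A \<Longrightarrow> map_mat f (top_rows l A) = top_rows l (map_mat f A)"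
  by (intro eq_matI) (auto simp: top_rows_def)

lemma set_rows_top_rows:
  assumes "l \<le> dim_row A"
  shows "set (rows (top_rows l A)) = row A ` {..<l}"
proof -
  have "row (top_rows l A) i = row A i" if "i < l" for i
    using that assms by (intro eq_vecI) (auto simp: top_rows_def)
  then show ?thesis
    by (auto simp: rows_def top_rows_def atLeast0LessThan image_iff)
qed

section \<open>The radical\<close>

text \<open>For \<open>z = c R\<close> in the radical, \<open>z B = 0\<close> would make both
  summands of the Gram matrix kill \<open>z\<close>. The column number \<open>m\<close> is arbitrary
  here, which later yields the lower bound on the length.\<close>

lemma inj_mat_gram_on_radical:
  fixes A B R :: "'a::field mat"
  assumes A: "A \<in> carrier_mat k k" "transpose_mat A = A" and B: "B \<in> carrier_mat k m"
    and R: "R \<in> carrier_mat l k" "inj_mat (transpose_mat R)" "Rad A = row_combs R"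
    and inj: "inj_mat (A + B * transpose_mat B)"
  shows "inj_mat (transpose_mat (R * B))"
proof (rule inj_matI)
  show "transpose_mat (R * B) \<in> carrier_mat m l" using R B by simp
  fix c assume c: "c \<in> carrier_vec l" and 0: "transpose_mat (R * B) *\<^sub>v c = 0\<^sub>v m"
  have tR: "transpose_mat R \<in> carrier_mat k l" and tB: "transpose_mat B \<in> carrier_mat m k"
    using R B by simp_all
  define z where "z = transpose_mat R *\<^sub>v c"
  have z: "z \<in> carrier_vec k" using tR c by (simp add: z_def)
  have "z \<in> Rad A" using R(1,3) c row_combsI[of c R] by (simp add: z_def)
  then have Az: "A *\<^sub>v z = 0\<^sub>v k" using A by (simp add: Rad_def)
  have "transpose_mat B *\<^sub>v z = 0\<^sub>v m"
    using 0 assoc_mult_mat_vec[OF tB tR c] by (simp add: z_def transpose_mult[OF R(1) B])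
  then have "B * transpose_mat B *\<^sub>v z = 0\<^sub>v k"
    using assoc_mult_mat_vec[OF B tB z] mult_mat_zero_vec[OF B] by simp
  then have "(A + B * transpose_mat B) *\<^sub>v z = 0\<^sub>v k"
    using Az add_mult_distrib_mat_vec[OF A(1) _ z, of "B * transpose_mat B"] B by simp
  then have "z = 0\<^sub>v k"
    using inj_matD[OF inj _ z, of k] A B by simp
  then show "c = 0\<^sub>v l"
    unfolding z_def by (rule inj_matD[OF R(2) tR c])
qed

lemma inj_mat_gram_iff:
  fixes A B R :: "'a::{field, finite} mat"
  assumes A: "A \<in> carrier_mat k k" "transpose_mat A = A" and B: "B \<in> carrier_mat k l"
    and R: "R \<in> carrier_mat l k" "inj_mat (transpose_mat R)" "Rad A = row_combs R"
  shows "inj_mat (A + B * transpose_mat B) \<longleftrightarrow> inj_mat (R * B)"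
proof
  have RB: "R * B \<in> carrier_mat l l" using R B by simp
  {
    assume "inj_mat (A + B * transpose_mat B)"
    from inj_mat_transpose[OF inj_mat_gram_on_radical[OF A B R this]] RB
    show "inj_mat (R * B)" by simp
  }
  assume inj: "inj_mat (R * B)"
  have tR: "transpose_mat R \<in> carrier_mat k l" and tB: "transpose_mat B \<in> carrier_mat l k"
    using R B by simp_all
  show "inj_mat (A + B * transpose_mat B)"
  proof (rule inj_matI)
    fix z assume z: "z \<in> carrier_vec k" and 0: "(A + B * transpose_mat B) *\<^sub>v z = 0\<^sub>v k"
    define y where "y = transpose_mat B *\<^sub>v z"
    have y: "y \<in> carrier_vec l" using tB z by (simp add: y_def)
    have sum: "A *\<^sub>v z + B *\<^sub>v y = 0\<^sub>v k"
      using 0 add_mult_distrib_mat_vec[OF A(1) _ z, of "B * transpose_mat B"] B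
        assoc_mult_mat_vec[OF B tB z] by (simp add: y_def)
    \<comment> \<open>The rows of \<open>R\<close> lie in the radical, so each is orthogonal to
      every vector \<open>A z\<close>.\<close>
    have "R *\<^sub>v (A *\<^sub>v z) = 0\<^sub>v l"
    proof (rule eq_vecI)
      fix i assume "i < dim_vec (0\<^sub>v l :: 'a vec)"
      then have i: "i < l" by simp
      have "row R i \<in> Rad A" using row_in_row_combs[of i R] i R by simp
      then have "transpose_mat A *\<^sub>v row R i = 0\<^sub>v k" "row R i \<in> carrier_vec k"
        using A by (simp_all add: Rad_def)
      then have "row R i \<bullet> (A *\<^sub>v z) = 0"
        using transpose_vec_mult_scalar[OF A(1) z, of "row R i"] z by simp
      then show "(R *\<^sub>v (A *\<^sub>v z)) $ i = 0\<^sub>v l $ i" using i R by simp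
    qed (use R in simp)
    moreover have "R *\<^sub>v (A *\<^sub>v z) + R *\<^sub>v (B *\<^sub>v y) = 0\<^sub>v l"
      using mult_add_distrib_mat_vec[OF R(1), of "A *\<^sub>v z" "B *\<^sub>v y"] sum A B z y
        mult_mat_zero_vec[OF R(1)] by simp
    ultimately have "R * B *\<^sub>v y = 0\<^sub>v l"
      using assoc_mult_mat_vec[OF R(1) B y]
        left_zero_vec[OF mult_mat_vec_carrier[OF R(1) mult_mat_vec_carrier[OF B y]]] by simp
    then have y0: "y = 0\<^sub>v l" by (rule inj_matD[OF inj RB y])
    then have "A *\<^sub>v z = 0\<^sub>v k" using sum A z mult_mat_zero_vec[OF B] by simp
    then have "z \<in> Rad A" using A z by (simp add: Rad_def)
    then obtain c where c: "c \<in> carrier_vec l" "z = transpose_mat R *\<^sub>v c"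
      using R(1,3) by (auto simp: row_combs_def)
    have "transpose_mat (R * B) *\<^sub>v c = 0\<^sub>v l"
      using y0 assoc_mult_mat_vec[OF tB tR c(1)] unfolding y_def c(2)
      by (simp add: transpose_mult[OF R(1) B])
    \<comment> \<open>Now \<open>R B\<close> is square, so injectivity passes to its transpose and
      kills the coefficients \<open>c\<close> of \<open>z\<close>.\<close>
    moreover have "inj_mat (transpose_mat (R * B))" by (rule inj_mat_transpose[OF inj RB])
    ultimately have "c = 0\<^sub>v l" using inj_matD[of "transpose_mat (R * B)" l l c] RB c(1) by simp
    then show "z = 0\<^sub>v k" using c(2) mult_mat_zero_vec[OF tR] by simp
  qed (use A B in simp)
qed

section \<open>The radical as a kernel: dimension bound and bases\<close>

lemma Rad_eq_mat_kernel: "Rad A = mat_kernel (transpose_mat A)"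
  by (auto simp: Rad_def mat_kernel_def)

lemma dim_Rad_space_le:
  fixes A :: "'a::field mat"
  assumes "A \<in> carrier_mat k k"
  shows "vectorspace.dim class_ring (Rad_space A) \<le> k"
proof -
  have "vectorspace.dim class_ring (Rad_space A) = kernel_dim (transpose_mat A)"
    using assms by (simp add: kernel_dim_def Rad_eq_mat_kernel)
  then show ?thesis using assms by (simp add: kernel_dim_code)
qed

text \<open>Spans inside the radical and inside the ambient space coincide, which turns the abstract
  basis into explicit row combinations.\<close>

lemma Rad_basis_row_combs:
  fixes A R :: "'a::field mat"
  assumes A: "A \<in> carrier_mat k k" and R: "dim_col R = k"
    and basis: "vectorspace.basis class_ring (Rad_space A) (set (rows R))"
  shows "Rad A = row_combs R"
proof -
  interpret kernel k k "transpose_mat A" by standard (use A in simp)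
  have "basis (set (rows R))"
    using basis A by (simp add: Rad_eq_mat_kernel)
  then have "span (set (rows R)) = mat_kernel (transpose_mat A)"
    and sub: "set (rows R) \<subseteq> mat_kernel (transpose_mat A)"
    by (auto simp: Ker.basis_def)
  then show ?thesis
    using span_same[OF sub] span_rows[OF R] by (simp add: Rad_eq_mat_kernel)
qed

section \<open>Shortest LCD embeddings\<close>

lemma mat_inverse_invertible:
  fixes U :: "'a::{field, finite} mat"
  assumes U: "U \<in> carrier_mat k k" "invertible_mat U"
  shows "the (mat_inverse U) \<in> carrier_mat k k" "U * the (mat_inverse U) = 1\<^sub>m k"
    "the (mat_inverse U) * U = 1\<^sub>m k"
proof -
  obtain X where X: "X \<in> carrier_mat k k" "U * X = 1\<^sub>m k" "X * U = 1\<^sub>m k"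
    using inj_mat_inverse U invertible_mat_iff_inj_mat by metis
  then have "U \<in> Units (ring_mat TYPE('a) k ())"
    using U by (auto simp: Units_def ring_mat_simps)
  then obtain V where "mat_inverse U = Some V"
    using mat_inverse(1)[OF U(1)] by (metis option.exhaust)
  then show "the (mat_inverse U) \<in> carrier_mat k k" "U * the (mat_inverse U) = 1\<^sub>m k"
    "the (mat_inverse U) * U = 1\<^sub>m k"
    using mat_inverse(2)[OF U(1)] by auto
qed

theorem theorem6p3:
  fixes C :: "'a::{field, finite} dual_num vec set"
    and G :: "'a dual_num mat"
    and A0 A1 U :: "'a mat"
    and n k l N :: nat
    and C' :: "'a dual_num vec set"
  assumes "linear_code n C"
    and "generator_matrix n C G"
    and "dim_row G = k"
    and "A0 \<in> carrier_mat k k" and "A1 \<in> carrier_mat k k"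
    and "G * transpose_mat G = map_mat emb A0 + u \<cdot>\<^sub>m map_mat emb A1"
    and "l = vectorspace.dim class_ring (Rad_space A0)"
    and "U \<in> carrier_mat k k" and "invertible_mat U"
    and "vectorspace.basis class_ring (Rad_space A0) (row U ` {..<l})"
  shows "shortest_lcd_embedding n C N C' \<longleftrightarrow>
    (\<exists>D E. D \<in> carrier_mat l l \<and> invertible_mat D \<and> E \<in> carrier_mat (k - l) l \<and>
       generator_matrix N C'
         (append_cols G (map_mat emb (the (mat_inverse U)) * (D @\<^sub>r E))))"
proof -
  note gen = assms(2) and A0 = assms(4) and U = assms(8,9)
  have G: "G \<in> carrier_mat k n" using gen assms(3) by (auto simp: generator_matrix_def)
  have l: "l \<le> k" using dim_Rad_space_le[OF A0] assms(7) by simp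
  have A0_eq: "map_mat res (G * transpose_mat G) = A0"
    unfolding assms(6) using assms(4,5) by (intro eq_matI) auto
  have A0_sym: "transpose_mat A0 = A0"
    using transpose_mult[OF G, of "transpose_mat G" k] G
    by (simp add: map_mat_transpose flip: A0_eq)
  have gram: "map_mat res (G * transpose_mat G + B * transpose_mat B)
      = A0 + map_mat res B * transpose_mat (map_mat res B)" if B: "B \<in> carrier_mat k m" for B m
  proof -
    have "map_mat res (G * transpose_mat G + B * transpose_mat B)
        = A0 + map_mat res (B * transpose_mat B)"
      unfolding A0_eq[symmetric] using G B by (intro eq_matI) auto
    then show ?thesis
      using res_hom.mat_hom_mult[OF B, of "transpose_mat B" k] B by (simp add: map_mat_transpose)
  qed
  define V where "V = the (mat_inverse U)"
  have V: "V \<in> carrier_mat k k" "U * V = 1\<^sub>m k" "V * U = 1\<^sub>m k"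
    unfolding V_def by (rule mat_inverse_invertible[OF U])+
  define R where "R = top_rows l U"
  have R: "R \<in> carrier_mat l k" using U by (simp add: R_def)
  have Rad: "Rad A0 = row_combs R"
  proof (rule Rad_basis_row_combs[OF A0])
    show "dim_col R = k" using R by simp
    show "vectorspace.basis class_ring (Rad_space A0) (set (rows R))"
      using assms(10) U l by (simp add: R_def set_rows_top_rows)
  qed
  define U' V' R' :: "'a dual_num mat"
    where "U' = map_mat emb U" and "V' = map_mat emb V" and "R' = map_mat emb R"
  have c: "U' \<in> carrier_mat k k" "V' \<in> carrier_mat k k" "R' \<in> carrier_mat l k"
    using U V R by (simp_all add: U'_def V'_def R'_def)
  have VU: "V' * U' = 1\<^sub>m k" and UV: "U' * V' = 1\<^sub>m k"
    using emb_hom.mat_hom_mult[OF V(1) U(1)] emb_hom.mat_hom_mult[OF U(1) V(1)] V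
    by (simp_all add: U'_def V'_def emb_hom.mat_hom_one)
  have R'_mult: "R' * B = top_rows l (U' * B)" if "B \<in> carrier_mat k m" for B m
    using top_rows_mult[OF c(1) that l] U l by (simp add: R'_def R_def U'_def map_mat_top_rows)
  \<comment> \<open>The block \<open>D\<close> is recovered from \<open>B\<close> by multiplying
    with the first \<open>l\<close> rows of \<open>U\<close>, since \<open>U\<close> cancels its
    inverse.\<close>
  have R'_V': "R' * (V' * (D @\<^sub>r E)) = D" if D: "D \<in> carrier_mat l m" and E: "E \<in> carrier_mat (k - l) m"
    for D E :: "'a dual_num mat" and m
  proof -
    have X: "D @\<^sub>r E \<in> carrier_mat k m" using carrier_append_rows[OF D E] l by simp
    have "U' * (V' * (D @\<^sub>r E)) = D @\<^sub>r E"
      using assoc_mult_mat[OF c(1,2) X] UV left_mult_one_mat[OF X] by simp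
    then show ?thesis
      using R'_mult[OF mult_carrier_mat[OF c(2) X]] top_rows_append_rows[OF D E] by simp
  qed
  \<comment> \<open>The sample choice \<open>D = 1\<close>, \<open>E = 0\<close>. It shows that
    length \<open>n + l\<close> is attained, and its residue is a right inverse of
    \<open>R\<close>.\<close>
  define B1 where "B1 = V' * (1\<^sub>m l @\<^sub>r 0\<^sub>m (k - l) l)"
  have B1: "B1 \<in> carrier_mat k l"
    using mult_carrier_mat[OF c(2), of "1\<^sub>m l @\<^sub>r 0\<^sub>m (k - l) l" l]
      carrier_append_rows[of "1\<^sub>m l" l l "0\<^sub>m (k - l) l" "k - l"] l
    by (simp add: B1_def)
  have res_R'B: "map_mat res (R' * B) = R * map_mat res B" if "B \<in> carrier_mat k m" for B m
    using res_hom.mat_hom_mult[OF c(3) that] by (simp add: R'_def)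
  have RB1: "R * map_mat res B1 = 1\<^sub>m l"
    using res_R'B[OF B1] R'_V'[of "1\<^sub>m l" l "0\<^sub>m (k - l) l"]
    by (simp add: B1_def res_hom.mat_hom_one)
  \<comment> \<open>Transposing \<open>R B1 = 1\<close> modulo \<open>u\<close> gives a left inverse
    of the transpose, that is, independence of the rows of \<open>R\<close>.\<close>
  have injR: "inj_mat (transpose_mat R)"
    using transpose_mult[OF R, of "map_mat res B1" l] B1 R RB1
    by (intro inj_mat_leftI[of _ k l "transpose_mat (map_mat res B1)"]) auto
  have inj_iff: "inj_mat (map_mat res (G * transpose_mat G + B * transpose_mat B)) \<longleftrightarrow> inj_mat (R' * B)"
    if B: "B \<in> carrier_mat k l" for B
  proof -
    have "map_mat res B \<in> carrier_mat k l" "R' * B \<in> carrier_mat l l" using B c by simp_all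
    then show ?thesis
      unfolding gram[OF B] using inj_mat_gram_iff[OF A0 A0_sym _ R injR Rad, of "map_mat res B"]
        inj_mat_res_iff[of "R' * B" l] res_R'B[OF B] by simp
  qed
  \<comment> \<open>Injectivity of \<open>c\<close> mapped to \<open>c R B\<close> modulo
    \<open>u\<close>, from dimension \<open>l\<close> to dimension \<open>m\<close>, bounds the
    number of added columns.\<close>
  have len: "l \<le> m"
    if B: "B \<in> carrier_mat k m" and inj: "inj_mat (map_mat res (G * transpose_mat G + B * transpose_mat B))"
    for B m
  proof -
    have rB: "map_mat res B \<in> carrier_mat k m" using B by simp
    show ?thesis
      using inj_mat_gram_on_radical[OF A0 A0_sym rB R injR Rad] inj R rB
      unfolding gram[OF B] by (intro inj_mat_dim_le[of "transpose_mat (R * map_mat res B)"]) simp_all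
  qed
  have emb_iff: "lcd_embedding n C M D \<longleftrightarrow> (\<exists>m B. B \<in> carrier_mat k m \<and> M = n + m \<and>
    D = row_combs (append_cols G B) \<and> inj_mat (map_mat res (G * transpose_mat G + B * transpose_mat B)))"
    for M D by (rule lcd_embedding_iff[OF gen G])
  have "inj_mat (R' * B1)"
    using R'_V'[of "1\<^sub>m l" l "0\<^sub>m (k - l) l"] by (simp add: B1_def inj_mat_def)
  then have ex: "lcd_embedding n C (n + l) (row_combs (append_cols G B1))"
    using emb_iff inj_iff[OF B1] B1 by blast
  \<comment> \<open>Minimality becomes a condition on \<open>R' B\<close> alone: \<open>B1\<close>
    bounds the least length from above and \<open>len\<close> from below.\<close>
  have shortest: "shortest_lcd_embedding n C N C' \<longleftrightarrow> N = n + l \<and> (\<exists>B. B \<in> carrier_mat k l \<and>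
      C' = row_combs (append_cols G B) \<and> inj_mat (R' * B))"
  proof
    assume S: "shortest_lcd_embedding n C N C'"
    then obtain m B where B: "B \<in> carrier_mat k m" and N: "N = n + m"
      and C': "C' = row_combs (append_cols G B)"
      and inj: "inj_mat (map_mat res (G * transpose_mat G + B * transpose_mat B))"
      using emb_iff unfolding shortest_lcd_embedding_def by blast
    have "N \<le> n + l" using S ex unfolding shortest_lcd_embedding_def by blast
    then have "m = l" using len[OF B inj] N by simp
    then show "N = n + l \<and> (\<exists>B. B \<in> carrier_mat k l \<and>
        C' = row_combs (append_cols G B) \<and> inj_mat (R' * B))"
      using B N C' inj inj_iff by blast
  next
    assume "N = n + l \<and> (\<exists>B. B \<in> carrier_mat k l \<and>
      C' = row_combs (append_cols G B) \<and> inj_mat (R' * B))"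
    then have "lcd_embedding n C N C'" and N: "N = n + l"
      using emb_iff inj_iff by blast+
    moreover have "N \<le> N'" if "lcd_embedding n C N' D'" for N' D'
    proof -
      from that obtain m B where "B \<in> carrier_mat k m" "N' = n + m"
        "inj_mat (map_mat res (G * transpose_mat G + B * transpose_mat B))"
        using emb_iff by blast
      then show ?thesis using len[of B m] N by simp
    qed
    ultimately show "shortest_lcd_embedding n C N C'"
      unfolding shortest_lcd_embedding_def by blast
  qed
  show ?thesis
    unfolding V_def[symmetric] V'_def[symmetric] shortest
  proof
    assume "N = n + l \<and> (\<exists>B. B \<in> carrier_mat k l \<and>
      C' = row_combs (append_cols G B) \<and> inj_mat (R' * B))"
    then obtain B where N: "N = n + l" and B: "B \<in> carrier_mat k l"
      and C': "C' = row_combs (append_cols G B)" and inj: "inj_mat (R' * B)"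
      by blast
    have UB: "U' * B \<in> carrier_mat k l" using c B by simp
    \<comment> \<open>Splitting \<open>U B\<close> after \<open>l\<close> rows gives the two blocks;
      the upper one is \<open>R' B\<close> and plays the role of \<open>D\<close>.\<close>
    obtain E where E: "E \<in> carrier_mat (k - l) l" "U' * B = top_rows l (U' * B) @\<^sub>r E"
      using append_rows_split[OF UB l] .
    have RB: "R' * B \<in> carrier_mat l l" using c B by simp
    have "V' * (U' * B) = B"
      using assoc_mult_mat[OF c(2,1) B] VU left_mult_one_mat[OF B] by simp
    then have B_eq: "V' * (R' * B @\<^sub>r E) = B"
      using E(2) R'_mult[OF B] by simp
    have "generator_matrix N C' (append_cols G B)"
      unfolding N C'
    proof (rule inj_gram_imp_generator_matrix[OF append_cols_carrier[OF G B]])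
      show "inj_mat (map_mat res (append_cols G B * transpose_mat (append_cols G B)))"
        unfolding gram_append_cols[OF G B] inj_iff[OF B] by (rule inj)
    qed
    then show "\<exists>D E. D \<in> carrier_mat l l \<and> invertible_mat D \<and> E \<in> carrier_mat (k - l) l \<and>
        generator_matrix N C' (append_cols G (V' * (D @\<^sub>r E)))"
      using RB inj E(1) invertible_mat_iff_inj_mat[OF RB] B_eq by metis
  next
    assume "\<exists>D E. D \<in> carrier_mat l l \<and> invertible_mat D \<and> E \<in> carrier_mat (k - l) l \<and>
        generator_matrix N C' (append_cols G (V' * (D @\<^sub>r E)))"
    then obtain D E where D: "D \<in> carrier_mat l l" "invertible_mat D"
      and E: "E \<in> carrier_mat (k - l) l"
      and gen': "generator_matrix N C' (append_cols G (V' * (D @\<^sub>r E)))"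
      by blast
    define B where "B = V' * (D @\<^sub>r E)"
    have B: "B \<in> carrier_mat k l"
      using mult_carrier_mat[OF c(2), of "D @\<^sub>r E" l] carrier_append_rows[OF D(1) E] l
      by (simp add: B_def)
    \<comment> \<open>The length is forced by the column count of the generator matrix.\<close>
    have "N = n + l"
      using gen' G B by (simp add: generator_matrix_def flip: B_def)
    moreover have "C' = row_combs (append_cols G B)"
      unfolding B_def by (rule generator_matrix_code[OF gen'])
    moreover have "inj_mat (R' * B)"
      using D invertible_mat_iff_inj_mat[OF D(1)] R'_V'[OF D(1) E] by (simp add: B_def)
    ultimately show "N = n + l \<and> (\<exists>B. B \<in> carrier_mat k l \<and>
        C' = row_combs (append_cols G B) \<and> inj_mat (R' * B))"
      using B by blast
  qed
qed

end
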